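(* Let $p$ be an odd prime and let $E$ be any non-pythagorean field that admits a Galois extension $F/E$ with $[F:E] = p$. (1) Then there exists a non-pythagorean algebraic extension $E_0/E$ such that $E_0$ and $F$ are linearly disjoint over $E$ and, setting $F_0 = E_0 F$, we have $(F_0)_{\mathrm{pyth}} = (E_0)_{\mathrm{pyth}} F$ and $[(F_0)_{\mathrm{pyth}} : (E_0)_{\mathrm{pyth}}] = [F:E] = p$. (2) If $E$ is real, then it can be arranged that $E_0$ is real in addition to the conditions in (1). In particular, $(E_0)_{\mathrm{pyth}}$ is not hereditarily non-pythagorean.
   Context: All algebraic extensions and composita are taken inside a fixed algebraic closure of $E$. A field $K$ is pythagorean if every sum of squares of elements of $K$ is a square in $K$; it is real if $-1$ is not a sum of squares in $K$. For a field $K$, the pythagorean closure $K_{\mathrm{pyth}}$ is the direct limit (union) of all finite extensions of $K$ obtained by finite chains of quadratic extensions, each given by adjoining a square root of a sum of two squares of the preceding field. A field $k$ is hereditarily non-pythagorean if every proper finite extension of $k$ that is not purely inseparable over $k$ is non-pythagorean. *)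

theory Defs
  imports "HOL-Algebra.Algebraic_Closure" "HOL-Algebra.Generated_Fields" "HOL-Computational_Algebra.Primes"
begin

text \<open>All fields are subfields, given by their carrier sets, of one ambient field \<open>L\<close>.
  Where the definitions below quantify over extension fields or over roots, they are meant for
  an \<open>L\<close> that is an algebraic closure of the base field.\<close>

definition is_sum_of_squares :: "('a, 'b) ring_scheme \<Rightarrow> 'a set \<Rightarrow> 'a \<Rightarrow> bool" where
  "is_sum_of_squares L K x \<longleftrightarrow>
     (\<exists>(n::nat) f. f \<in> {..<n} \<rightarrow> K \<and> x = (\<Oplus>\<^bsub>L\<^esub>i\<in>{..<n}. f i \<otimes>\<^bsub>L\<^esub> f i))"

definition pythagorean :: "('a, 'b) ring_scheme \<Rightarrow> 'a set \<Rightarrow> bool" where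
  "pythagorean L K \<longleftrightarrow> (\<forall>x. is_sum_of_squares L K x \<longrightarrow> (\<exists>y\<in>K. x = y \<otimes>\<^bsub>L\<^esub> y))"

definition formally_real :: "('a, 'b) ring_scheme \<Rightarrow> 'a set \<Rightarrow> bool" where
  "formally_real L K \<longleftrightarrow> \<not> is_sum_of_squares L K (\<ominus>\<^bsub>L\<^esub> \<one>\<^bsub>L\<^esub>)"

text \<open>In \<open>step\<close> the element \<open>c\<close> is algebraic over \<open>M\<close>, so \<open>simple_extension L M c\<close>, which is
  the ring \<open>M[c]\<close>, is the field \<open>M(c)\<close>.\<close>

inductive pyth_tower :: "('a, 'b) ring_scheme \<Rightarrow> 'a set \<Rightarrow> 'a set \<Rightarrow> bool"
  for L (structure) and K where
  base: "pyth_tower L K K"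
| step: "\<lbrakk> pyth_tower L K M; a \<in> M; b \<in> M; c \<in> carrier L; c \<otimes> c = (a \<otimes> a) \<oplus> (b \<otimes> b);
          ring.dimension L 2 M (ring.simple_extension L M c) \<rbrakk>
         \<Longrightarrow> pyth_tower L K (ring.simple_extension L M c)"

definition pyth_closure :: "('a, 'b) ring_scheme \<Rightarrow> 'a set \<Rightarrow> 'a set" where
  "pyth_closure L K = \<Union> {M. pyth_tower L K M}"

definition compositum :: "('a, 'b) ring_scheme \<Rightarrow> 'a set \<Rightarrow> 'a set \<Rightarrow> 'a set" where
  "compositum L A B = generate_field L (A \<union> B)"

definition field_extension :: "('a, 'b) ring_scheme \<Rightarrow> 'a set \<Rightarrow> 'a set \<Rightarrow> bool" where
  "field_extension L K M \<longleftrightarrow> subfield K L \<and> subfield M L \<and> K \<subseteq> M"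

definition algebraic_extension :: "('a, 'b) ring_scheme \<Rightarrow> 'a set \<Rightarrow> 'a set \<Rightarrow> bool" where
  "algebraic_extension L K M \<longleftrightarrow>
     field_extension L K M \<and> (\<forall>x\<in>M. (ring.algebraic L over K) x)"

text \<open>The minimal polynomial has no multiple root; all its roots lie in \<open>L\<close>.\<close>

definition separable_element :: "('a, 'b) ring_scheme \<Rightarrow> 'a set \<Rightarrow> 'a \<Rightarrow> bool" where
  "separable_element L K x \<longleftrightarrow>
     (ring.algebraic L over K) x \<and>
     (\<forall>a\<in>carrier L. ring.alg_mult L (ring.Irr L K x) a \<le> 1)"

definition normal_extension :: "('a, 'b) ring_scheme \<Rightarrow> 'a set \<Rightarrow> 'a set \<Rightarrow> bool" where
  "normal_extension L K M \<longleftrightarrow>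
     algebraic_extension L K M \<and>
     (\<forall>x\<in>M. \<forall>a. ring.is_root L (ring.Irr L K x) a \<longrightarrow> a \<in> M)"

definition galois_extension :: "('a, 'b) ring_scheme \<Rightarrow> 'a set \<Rightarrow> 'a set \<Rightarrow> bool" where
  "galois_extension L K M \<longleftrightarrow>
     normal_extension L K M \<and> (\<forall>x\<in>M. separable_element L K x)"

definition purely_inseparable :: "('a, 'b) ring_scheme \<Rightarrow> 'a set \<Rightarrow> 'a set \<Rightarrow> bool" where
  "purely_inseparable L K M \<longleftrightarrow>
     algebraic_extension L K M \<and> (\<forall>x\<in>M - K. \<not> separable_element L K x)"

definition linearly_disjoint ::
  "('a, 'b) ring_scheme \<Rightarrow> 'a set \<Rightarrow> 'a set \<Rightarrow> 'a set \<Rightarrow> bool" where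
  "linearly_disjoint L K A B \<longleftrightarrow>
     (\<forall>Us. set Us \<subseteq> B \<and> ring.independent L K Us \<longrightarrow> ring.independent L A Us)"

definition hereditarily_non_pythagorean :: "('a, 'b) ring_scheme \<Rightarrow> 'a set \<Rightarrow> bool" where
  "hereditarily_non_pythagorean L K \<longleftrightarrow>
     (\<forall>M. field_extension L K M \<and> ring.finite_dimension L K M \<and> M \<noteq> K \<and>
          \<not> purely_inseparable L K M \<longrightarrow> \<not> pythagorean L M)"

end

theory Submission
  imports Defs
begin

text \<open>Let \<open>d\<close> be a sum of squares in \<open>E\<close> that is not a square in \<open>E\<close>, and put
  \<open>T = F\<^sub>p\<^sub>y\<^sub>t\<^sub>h\<close>. Choose an endomorphism \<open>h\<close> of \<open>T\<close> over \<open>E\<close> that is nontrivial on \<open>F\<close> and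
  maps the square root of \<open>d\<close> to its negative, and let \<open>E\<^sub>0\<close> be its fixed field in \<open>T\<close>; it is
  real if \<open>E\<close> is, since then \<open>T\<close> is. The point of working inside \<open>T\<close> rather than the algebraic
  closure is that an element of a field between \<open>E\<close> and \<open>T\<close> that is a square in \<open>T\<close> is a sum of
  squares in that field, by Springer's theorem for the odd degree of \<open>F\<close>. Hence the pythagorean
  closure of the fixed field of \<open>h ^^ j\<close> is the union of the fixed fields of \<open>h ^^ (j * 2 ^ k)\<close>.
  Since \<open>x \<in> F - E\<close> has exactly \<open>p\<close> conjugates under \<open>h ^^ m\<close> for \<open>m\<close> prime to \<open>p\<close>,
  interpolation at these conjugates shows that \<open>1, x, \<dots>, x ^ (p - 1)\<close> is a basis of the fixed
  field of \<open>h ^^ (m * p)\<close> over that of \<open>h ^^ m\<close>; take \<open>m = 2 ^ k\<close>.\<close>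

subsection \<open>Sums of squares\<close>

text \<open>Why iterates by powers of 2: if \<open>g\<close> fixes the square of an element, it maps
  the element to itself or to its negative, so \<open>g ^^ 2\<close> fixes the element. Closing a
  fixed field under the required square roots therefore only ever doubles the iterate. As
  \<open>p\<close> is odd, these iterates never become trivial on \<open>F\<close>, and the degree
  \<open>p\<close> survives in the limit. The prescribed sign on the square root of \<open>d\<close>
  keeps \<open>d\<close> from being a square in the fixed field. Both demands on \<open>h\<close>
  are compatible because the square root of \<open>d\<close> has degree 2 over \<open>E\<close>
  while \<open>F\<close> has odd degree. Springer's theorem serves the converse inclusion: the
  doubled fixed field must be reached by roots of sums of squares, not merely by square roots. Fixed
  fields of iterates of one endomorphism replace an infinite Galois correspondence, and
  interpolation yields the same list of powers of \<open>x\<close> as a basis at every level.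
  Characteristic 2 cannot occur, since every field of that characteristic is pythagorean.\<close>

context ring
begin

lemma is_sum_of_squares_zero: "is_sum_of_squares R K \<zero>"
  unfolding is_sum_of_squares_def
  by (rule exI[of _ 0], rule exI[of _ "\<lambda>_. \<zero>"]) simp

lemma is_sum_of_squares_add_square:
  assumes "K \<subseteq> carrier R" "is_sum_of_squares R K s" "a \<in> K"
  shows "is_sum_of_squares R K (s \<oplus> a \<otimes> a)"
proof -
  obtain n :: nat and f where f: "f \<in> {..<n} \<rightarrow> K" "s = (\<Oplus>i\<in>{..<n}. f i \<otimes> f i)"
    using assms(2) unfolding is_sum_of_squares_def by blast
  let ?f = "f(n := a)"
  have fc: "\<And>i. i < n \<Longrightarrow> f i \<in> carrier R" and a: "a \<in> carrier R" using f(1) assms(1,3) by auto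
  have "(\<Oplus>i\<in>{..<n}. ?f i \<otimes> ?f i) = s"
    unfolding f(2) using fc by (intro add.finprod_cong') auto
  moreover have "(\<Oplus>i\<in>insert n {..<n}. ?f i \<otimes> ?f i) = ?f n \<otimes> ?f n \<oplus> (\<Oplus>i\<in>{..<n}. ?f i \<otimes> ?f i)"
    by (rule add.finprod_insert) (use fc a in auto)
  moreover have "s \<in> carrier R"
    unfolding f(2) using fc by (intro finsum_closed) auto
  ultimately have "s \<oplus> a \<otimes> a = (\<Oplus>i\<in>{..<Suc n}. ?f i \<otimes> ?f i)"
    using a by (simp add: lessThan_Suc add.m_comm)
  moreover have "?f \<in> {..<Suc n} \<rightarrow> K" using f(1) assms(3) by (auto simp: less_Suc_eq)
  ultimately show ?thesis unfolding is_sum_of_squares_def by blast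
qed

text \<open>Sums of squares are handled by adding one square at a time. \<open>K\<close> is any
  subset of the carrier, so the rule also serves in \<open>K[X]\<close> with summands restricted to
  polynomials of bounded length.\<close>

lemma is_sum_of_squares_induct [consumes 2, case_names zero add_square]:
  assumes "is_sum_of_squares R K x" "K \<subseteq> carrier R"
    and "P \<zero>"
    and step: "\<And>s a. \<lbrakk> is_sum_of_squares R K s; P s; a \<in> K \<rbrakk> \<Longrightarrow> P (s \<oplus> a \<otimes> a)"
  shows "P x"
proof -
  have "P (\<Oplus>i\<in>{..<n}. f i \<otimes> f i)" if "f \<in> {..<n} \<rightarrow> K" for n :: nat and f
    using that
  proof (induction n)
    case 0
    then show ?case using assms(3) by simp
  next
    case (Suc n)
    have fc: "\<And>i. i < Suc n \<Longrightarrow> f i \<in> carrier R" using Suc.prems assms(2) by auto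
    have "(\<Oplus>i\<in>insert n {..<n}. f i \<otimes> f i) = f n \<otimes> f n \<oplus> (\<Oplus>i\<in>{..<n}. f i \<otimes> f i)"
      by (rule add.finprod_insert) (use fc in auto)
    moreover have "(\<Oplus>i\<in>{..<n}. f i \<otimes> f i) \<in> carrier R"
      using fc by (intro finsum_closed) auto
    ultimately have eq: "(\<Oplus>i\<in>{..<Suc n}. f i \<otimes> f i) = (\<Oplus>i\<in>{..<n}. f i \<otimes> f i) \<oplus> f n \<otimes> f n"
      using fc[of n] by (simp add: lessThan_Suc add.m_comm)
    have f': "f \<in> {..<n} \<rightarrow> K" using Suc.prems by auto
    then have "is_sum_of_squares R K (\<Oplus>i\<in>{..<n}. f i \<otimes> f i)"
      unfolding is_sum_of_squares_def by blast
    with eq step Suc.IH[OF f'] Suc.prems show ?case by auto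
  qed
  then show ?thesis using assms(1) unfolding is_sum_of_squares_def by blast
qed

lemma is_sum_of_squares_carrier:
  assumes "is_sum_of_squares R K x" "K \<subseteq> carrier R" shows "x \<in> carrier R"
  using assms by (induction rule: is_sum_of_squares_induct) (use assms(2) in auto)

lemma is_sum_of_squares_mono:
  assumes "is_sum_of_squares R K x" "K \<subseteq> K'" shows "is_sum_of_squares R K' x"
  using assms unfolding is_sum_of_squares_def by blast

lemma is_sum_of_squares_square:
  assumes "K \<subseteq> carrier R" "a \<in> K" shows "is_sum_of_squares R K (a \<otimes> a)"
  using is_sum_of_squares_add_square[OF assms(1) is_sum_of_squares_zero assms(2)] assms by auto

lemma is_sum_of_squares_mem:
  assumes "is_sum_of_squares R K x" "subring K R" shows "x \<in> K"
  using assms(1) subringE(1)[OF assms(2)]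
  by (induction rule: is_sum_of_squares_induct) (auto intro: subringE[OF assms(2)])

lemma is_sum_of_squares_add:
  assumes "K \<subseteq> carrier R" "is_sum_of_squares R K x" "is_sum_of_squares R K y"
  shows "is_sum_of_squares R K (x \<oplus> y)"
  using assms(3,1)
proof (induction rule: is_sum_of_squares_induct)
  case zero
  then show ?case using is_sum_of_squares_carrier[OF assms(2,1)] assms(2) by simp
next
  case (add_square s a)
  then have "x \<oplus> (s \<oplus> a \<otimes> a) = (x \<oplus> s) \<oplus> a \<otimes> a"
    using is_sum_of_squares_carrier[OF assms(2,1)] is_sum_of_squares_carrier[OF _ assms(1)] assms(1)
    by (auto simp: a_assoc)
  then show ?case using is_sum_of_squares_add_square[OF assms(1)] add_square by simp
qed

end

context cring
begin

lemma is_sum_of_squares_mult_square: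
  assumes "subring K R" "is_sum_of_squares R K x" "a \<in> K"
  shows "is_sum_of_squares R K (a \<otimes> a \<otimes> x)"
  using assms(2) subringE(1)[OF assms(1)]
proof (induction rule: is_sum_of_squares_induct)
  case zero
  then show ?case using is_sum_of_squares_zero assms(3) subringE(1)[OF assms(1)] by auto
next
  case (add_square s b)
  have c: "a \<in> carrier R" "b \<in> carrier R" "s \<in> carrier R"
    using add_square subringE(1)[OF assms(1)] assms(3) is_sum_of_squares_carrier by blast+
  have "a \<otimes> a \<otimes> (s \<oplus> b \<otimes> b) = a \<otimes> a \<otimes> s \<oplus> (a \<otimes> b) \<otimes> (a \<otimes> b)"
    using c by algebra
  then show ?case
    using is_sum_of_squares_add_square[OF subringE(1)[OF assms(1)] add_square.IH]
      subringE(6)[OF assms(1,3) add_square.hyps(2)] by simp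
qed

lemma is_sum_of_squares_mult:
  assumes "subring K R" "is_sum_of_squares R K x" "is_sum_of_squares R K y"
  shows "is_sum_of_squares R K (x \<otimes> y)"
  using assms(2) subringE(1)[OF assms(1)]
proof (induction rule: is_sum_of_squares_induct)
  case zero
  then show ?case
    using is_sum_of_squares_zero is_sum_of_squares_carrier[OF assms(3) subringE(1)[OF assms(1)]] by simp
next
  case (add_square s a)
  have c: "a \<in> carrier R" "s \<in> carrier R" "y \<in> carrier R"
    using add_square subringE(1)[OF assms(1)] assms(3) is_sum_of_squares_carrier by blast+
  have "(s \<oplus> a \<otimes> a) \<otimes> y = s \<otimes> y \<oplus> a \<otimes> a \<otimes> y" using c by algebra
  then show ?case
    using is_sum_of_squares_add[OF subringE(1)[OF assms(1)] add_square.IH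
        is_sum_of_squares_mult_square[OF assms(1,3) add_square.hyps(2)]] by simp
qed

end

context domain
begin

lemma square_eq_imp:
  assumes "x \<in> carrier R" "y \<in> carrier R" "x \<otimes> x = y \<otimes> y"
  shows "x = y \<or> x = \<ominus> y"
proof -
  have "(x \<ominus> y) \<otimes> (x \<oplus> y) = x \<otimes> x \<ominus> y \<otimes> y" using assms(1,2) by algebra
  then have "(x \<ominus> y) \<otimes> (x \<oplus> y) = \<zero>" using assms by (simp add: r_right_minus_eq)
  then have "x \<ominus> y = \<zero> \<or> x \<oplus> y = \<zero>"
    by (rule integral) (use assms(1,2) in auto)
  then show ?thesis using assms by (metis minus_equality r_right_minus_eq)
qed

end

context field
begin

text \<open>The quotient x/y equals (1/y)^2 (xy), and sums of squares are closed under
  products.\<close>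

lemma sum_of_squares_div:
  assumes "subfield K R" "is_sum_of_squares R K x" "is_sum_of_squares R K y" "y \<noteq> \<zero>"
  shows "is_sum_of_squares R K (x \<otimes> inv y)"
proof -
  note sr = subfieldE(1)[OF assms(1)] and sc = subfieldE(3)[OF assms(1)]
  have y: "y \<in> K - {\<zero>}" "y \<in> carrier R" and x: "x \<in> carrier R"
    using is_sum_of_squares_mem[OF assms(3) sr] is_sum_of_squares_carrier[OF assms(2) sc] assms(4) sc by auto
  note iy = subfield_m_inv[OF assms(1) y(1)]
  have "is_sum_of_squares R K (inv y \<otimes> inv y \<otimes> (x \<otimes> y))"
    using is_sum_of_squares_mult_square[OF sr is_sum_of_squares_mult[OF sr assms(2,3)]] iy(1) by blast
  moreover have "inv y \<otimes> inv y \<otimes> (x \<otimes> y) = x \<otimes> inv y \<otimes> (inv y \<otimes> y)"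
    using x y iy(1) sc by (simp add: m_comm m_assoc m_lcomm subset_iff)
  ultimately show ?thesis using x y iy sc by auto
qed

text \<open>Were \<open>y\<close> nonzero, -1 = x/y would be a quotient of sums of squares.\<close>

lemma formally_real_sum_zero:
  assumes "subfield K R" "formally_real R K"
    and "is_sum_of_squares R K x" "is_sum_of_squares R K y" "x \<oplus> y = \<zero>"
  shows "x = \<zero>" and "y = \<zero>"
proof -
  note sc = subfieldE(3)[OF assms(1)]
  have c: "x \<in> carrier R" "y \<in> carrier R" using is_sum_of_squares_carrier sc assms(3,4) by blast+
  have x: "x = \<ominus> y" using assms(5) c by (metis minus_equality)
  show y: "y = \<zero>"
  proof (rule ccontr)
    assume ny: "y \<noteq> \<zero>"
    have "is_sum_of_squares R K (x \<otimes> inv y)"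
      using sum_of_squares_div[OF assms(1,3,4) ny] .
    moreover have "x \<otimes> inv y = \<ominus> \<one>"
      using x ny c field_Units by (simp add: l_minus)
    ultimately show False using assms(2) unfolding formally_real_def by simp
  qed
  show "x = \<zero>" using x y by simp
qed

section \<open>Adjoining a square root to a field\<close>

lemma simple_extension_square_root:
  assumes "subring K R" "c \<in> carrier R" "c \<otimes> c \<in> K"
  shows "simple_extension K c = {a \<oplus> b \<otimes> c | a b. a \<in> K \<and> b \<in> K}"
proof
  note sc = subringE(1)[OF assms(1)]
  show "simple_extension K c \<subseteq> {a \<oplus> b \<otimes> c | a b. a \<in> K \<and> b \<in> K}"
  proof
    fix x assume "x \<in> simple_extension K c"
    then show "x \<in> {a \<oplus> b \<otimes> c | a b. a \<in> K \<and> b \<in> K}"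
    proof induction
      case zero
      have "\<zero> = \<zero> \<oplus> \<zero> \<otimes> c" using assms(2) by simp
      then show ?case using subringE(2)[OF assms(1)] by blast
    next
      case (lin k1 k2)
      then obtain a b where ab: "a \<in> K" "b \<in> K" "k1 = a \<oplus> b \<otimes> c" by blast
      have "a \<in> carrier R" "b \<in> carrier R" "k2 \<in> carrier R" using ab lin sc by auto
      then have "k1 \<otimes> c \<oplus> k2 = (b \<otimes> (c \<otimes> c) \<oplus> k2) \<oplus> a \<otimes> c"
        unfolding ab(3) using assms(2) by algebra
      moreover have "b \<otimes> (c \<otimes> c) \<oplus> k2 \<in> K"
        using subringE(6,7)[OF assms(1)] ab lin assms(3) by simp
      ultimately show ?case using ab by blast
    qed
  qed
  show "{a \<oplus> b \<otimes> c | a b. a \<in> K \<and> b \<in> K} \<subseteq> simple_extension K c"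
  proof clarify
    fix a b assume "a \<in> K" "b \<in> K"
    then have "a \<in> simple_extension K c" "b \<in> simple_extension K c"
      using simple_extension_incl[OF sc assms(2)] by auto
    then show "a \<oplus> b \<otimes> c \<in> simple_extension K c"
      using subringE(6,7)[OF simple_extension_is_subring[OF assms(1,2)]]
        simple_extension_mem[OF assms(1,2)] by simp
  qed
qed

lemma square_root_algebraic:
  assumes "subring K R" "c \<in> carrier R" "c \<otimes> c \<in> K"
  shows "(algebraic over K) c"
\<comment> \<open>Polynomials are coefficient lists with the leading coefficient first; this one is
  X^2 - c^2.\<close>
proof (rule algebraicI[of "[\<one>, \<zero>, \<ominus> (c \<otimes> c)]"])
  show "[\<one>, \<zero>, \<ominus> (c \<otimes> c)] \<in> carrier (K[X])"
    using subringE(2,3,5)[OF assms(1)] assms(3) unfolding univ_poly_def polynomial_def by auto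
  have "\<one> \<otimes> (c \<otimes> c) \<oplus> (\<zero> \<otimes> c \<oplus> (\<ominus> (c \<otimes> c) \<otimes> \<one> \<oplus> \<zero>)) = \<zero>" using assms(2) by algebra
  then show "eval [\<one>, \<zero>, \<ominus> (c \<otimes> c)] c = \<zero>"
    using assms(2) by (simp add: numeral_2_eq_2)
qed simp

lemma simple_extension_square_root_subfield:
  assumes "subfield K R" "c \<in> carrier R" "c \<otimes> c \<in> K"
  shows "subfield (simple_extension K c) R"
  using simple_extension_is_subfield[OF assms(1,2)]
    square_root_algebraic[OF subfieldE(1)[OF assms(1)] assms(2,3)] by simp

text \<open>Since (u + vc)^2 = u^2 + c^2 v^2 + 2uvc, the squares u^2 add up to \<open>A\<close>, the
  squares v^2 to \<open>B\<close>, and the cross terms 2uv to \<open>D\<close>.\<close>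

lemma is_sum_of_squares_simple_extension:
  assumes "subfield K R" "c \<in> carrier R" "c \<otimes> c \<in> K"
    and "is_sum_of_squares R (simple_extension K c) x"
  obtains A B D where "is_sum_of_squares R K A" "is_sum_of_squares R K B" "D \<in> K"
    "x = A \<oplus> (c \<otimes> c) \<otimes> B \<oplus> D \<otimes> c"
proof -
  note sr = subfieldE(1)[OF assms(1)]
  note sc = subringE(1)[OF sr]
  have "simple_extension K c \<subseteq> carrier R"
    using simple_extension_in_carrier[OF sc assms(2)] .
  with assms(4) have "\<exists>A B D. is_sum_of_squares R K A \<and> is_sum_of_squares R K B \<and> D \<in> K \<and>
    x = A \<oplus> (c \<otimes> c) \<otimes> B \<oplus> D \<otimes> c"
  proof (induction rule: is_sum_of_squares_induct)
    case zero
    have "\<zero> = \<zero> \<oplus> (c \<otimes> c) \<otimes> \<zero> \<oplus> \<zero> \<otimes> c" using assms(2) by simp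
    then show ?case using is_sum_of_squares_zero subringE(2)[OF sr] by blast
  next
    case (add_square s a)
    then obtain A B D where h: "is_sum_of_squares R K A" "is_sum_of_squares R K B" "D \<in> K"
      "s = A \<oplus> (c \<otimes> c) \<otimes> B \<oplus> D \<otimes> c" by blast
    obtain u v where uv: "u \<in> K" "v \<in> K" "a = u \<oplus> v \<otimes> c"
      using add_square.hyps(2) simple_extension_square_root[OF sr assms(2,3)] by blast
    have c: "A \<in> carrier R" "B \<in> carrier R" "D \<in> carrier R" "u \<in> carrier R" "v \<in> carrier R"
      using h uv sc is_sum_of_squares_carrier by blast+
    have "s \<oplus> a \<otimes> a = (A \<oplus> u \<otimes> u) \<oplus> (c \<otimes> c) \<otimes> (B \<oplus> v \<otimes> v) \<oplus> (D \<oplus> (u \<otimes> v \<oplus> u \<otimes> v)) \<otimes> c"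
      unfolding h(4) uv(3) using c assms(2) by algebra
    moreover have "D \<oplus> (u \<otimes> v \<oplus> u \<otimes> v) \<in> K" using subringE(6,7)[OF sr] h(3) uv by simp
    ultimately show ?case
      using is_sum_of_squares_add_square[OF sc] h(1,2) uv(1,2) by blast
  qed
  then show ?thesis using that by blast
qed

text \<open>If the coefficient of \<open>c\<close> in a representation of \<open>-1\<close> does not vanish, then \<open>c \<in> K\<close>.\<close>

lemma minus_one_sum_of_squares_simple_extension:
  assumes "subfield K R" "formally_real R K" "c \<in> carrier R" "c \<otimes> c \<in> K"
    and "\<not> formally_real R (simple_extension K c)"
  obtains A B where "is_sum_of_squares R K A" "is_sum_of_squares R K B"
    "\<ominus> \<one> = A \<oplus> (c \<otimes> c) \<otimes> B"
proof -
  note sr = subfieldE(1)[OF assms(1)]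
  note sc = subringE(1)[OF sr]
  obtain A B D where h: "is_sum_of_squares R K A" "is_sum_of_squares R K B" "D \<in> K"
    "\<ominus> \<one> = A \<oplus> (c \<otimes> c) \<otimes> B \<oplus> D \<otimes> c"
    using is_sum_of_squares_simple_extension[OF assms(1,3,4)] assms(5)
    unfolding formally_real_def by blast
  have c: "A \<in> K" "B \<in> K" using h is_sum_of_squares_mem sr by blast+
  have cc: "A \<in> carrier R" "B \<in> carrier R" "D \<in> carrier R" using c h(3) sc by auto
  have "c \<notin> K"
  proof
    assume "c \<in> K"
    then have "simple_extension K c = K"
      using simple_extension_incl[OF sc assms(3)] simple_extension_subring_incl[OF sr] by blast
    then show False using assms(2,5) by simp
  qed
  have "D = \<zero>"
  proof (rule ccontr)
    assume "D \<noteq> \<zero>"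
    have "D \<otimes> c = \<ominus> \<one> \<ominus> (A \<oplus> (c \<otimes> c) \<otimes> B)"
      unfolding h(4) using cc assms(3) by algebra
    moreover have "\<dots> \<in> K"
      using c assms(4) subringE(3,5,6,7)[OF sr] unfolding a_minus_def by simp
    ultimately have "c \<in> K"
      using subfield_m_inv_simprule[OF assms(1) _ assms(3)] h(3) \<open>D \<noteq> \<zero>\<close> by (metis Diff_iff singletonD)
    with \<open>c \<notin> K\<close> show False by simp
  qed
  then have "\<ominus> \<one> = A \<oplus> (c \<otimes> c) \<otimes> B" using h(4) cc assms(3) by simp
  then show ?thesis using that h by blast
qed

text \<open>When c^2 is itself a sum of squares, the representation of -1 by \<open>A\<close>,
  \<open>B\<close> and c^2 already takes place in \<open>K\<close>.\<close>

lemma formally_real_simple_extension: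
  assumes "subfield K R" "formally_real R K" "c \<in> carrier R" "is_sum_of_squares R K (c \<otimes> c)"
  shows "formally_real R (simple_extension K c)"
proof (rule ccontr)
  note sr = subfieldE(1)[OF assms(1)]
  assume "\<not> ?thesis"
  then obtain A B where "is_sum_of_squares R K A" "is_sum_of_squares R K B"
    "\<ominus> \<one> = A \<oplus> (c \<otimes> c) \<otimes> B"
    using minus_one_sum_of_squares_simple_extension[OF assms(1-3)
        is_sum_of_squares_mem[OF assms(4) sr]] by blast
  then have "is_sum_of_squares R K (\<ominus> \<one>)"
    using is_sum_of_squares_add[OF subringE(1)[OF sr]] is_sum_of_squares_mult[OF sr assms(4)] by simp
  then show False using assms(2) unfolding formally_real_def by simp
qed

end

subsection \<open>The pythagorean closure\<close>

lemma pyth_closure_incl: "K \<subseteq> pyth_closure L K"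
  unfolding pyth_closure_def using pyth_tower.base by blast

context field
begin

lemma pyth_tower_subfield:
  assumes "pyth_tower R K M" "subfield K R"
  shows "subfield M R" and "K \<subseteq> M"
proof -
  have "subfield M R \<and> K \<subseteq> M"
    using assms
  proof (induction rule: pyth_tower.induct)
    case base
    then show ?case by simp
  next
    case (step M a b c)
    then have M: "subfield M R" "K \<subseteq> M" by auto
    have "c \<otimes> c \<in> M" using step subringE(6,7)[OF subfieldE(1)[OF M(1)]] by simp
    then show ?case
      using simple_extension_square_root_subfield[OF M(1) step.hyps(4)] M(2)
        simple_extension_incl[OF subfieldE(3)[OF M(1)] step.hyps(4)] by auto
  qed
  then show "subfield M R" "K \<subseteq> M" by auto
qed

text \<open>Every step of a tower adjoins a root that \<open>T\<close> already contains. This is how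
  inclusions of a pythagorean closure in another field are proved later without induction on
  towers.\<close>

lemma pyth_closure_minimal:
  assumes "subfield T R" "K \<subseteq> T"
    and sqrt: "\<And>a b c. \<lbrakk> a \<in> T; b \<in> T; c \<in> carrier R; c \<otimes> c = a \<otimes> a \<oplus> b \<otimes> b \<rbrakk> \<Longrightarrow> c \<in> T"
  shows "pyth_closure R K \<subseteq> T"
proof -
  have "M \<subseteq> T" if "pyth_tower R K M" for M
    using that
  proof (induction rule: pyth_tower.induct)
    case base
    then show ?case using assms(2) .
  next
    case (step M a b c)
    then have "c \<in> T" using sqrt by blast
    then show ?case
      using simple_extension_subring_incl[OF subfieldE(1)[OF assms(1)] step.IH] by blast
  qed
  then show ?thesis unfolding pyth_closure_def by blast
qed

text \<open>The list \<open>[c, \<one>]\<close> is a basis. The exact degree matters because a step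
  of \<open>pyth_tower\<close> must be a genuine quadratic extension.\<close>

lemma dimension_simple_extension_square_root:
  assumes "subfield K R" "c \<in> carrier R" "c \<otimes> c \<in> K" "c \<notin> K"
  shows "dimension 2 K (simple_extension K c)"
proof -
  note sr = subfieldE(1)[OF assms(1)]
  have one: "independent K [\<one>]"
    by (rule li_Cons) (auto)
  have span1: "Span K [\<one>] = K"
    using assms(1) by (metis dimension_one dimension_independent one list.size(3,4)
        One_nat_def add.commute plus_1_eq_Suc independent_length_eq_dimension
        subringE(3)[OF sr] empty_subsetI insert_subset list.set)
  have ind: "independent K [c, \<one>]"
    by (rule li_Cons) (use assms(2,4) one span1 in auto)
  have "Span K [c, \<one>] = line_extension K c K" using span1 by simp
  also have "\<dots> = simple_extension K c"
  proof -
    have "b \<otimes> c \<oplus> a = a \<oplus> b \<otimes> c" if "a \<in> K" "b \<in> K" for a b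
      using that assms(2) subringE(1)[OF sr] by (simp add: a_comm subset_iff)
    then show ?thesis
      unfolding simple_extension_square_root[OF sr assms(2,3)]
      by (auto simp: line_extension_mem_iff) (metis, metis)
  qed
  finally show ?thesis
    using dimensionI[OF assms(1) ind] by (simp add: numeral_2_eq_2)
qed

text \<open>A root already in \<open>M\<close> cannot be adjoined by a step of degree 2; the tower
  then stays as it is.\<close>

lemma pyth_tower_extend:
  assumes "pyth_tower R K M" "subfield K R" "a \<in> M" "b \<in> M" "c \<in> carrier R"
    "c \<otimes> c = a \<otimes> a \<oplus> b \<otimes> b"
  obtains M' where "pyth_tower R K M'" "M \<subseteq> M'" "c \<in> M'"
proof (cases "c \<in> M")
  case True
  then show ?thesis
    using that assms(1) by blast
next
  case False
  note M = pyth_tower_subfield(1)[OF assms(1,2)]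
  have "c \<otimes> c \<in> M" using assms(3,4,6) subringE(6,7)[OF subfieldE(1)[OF M]] by simp
  then have "dimension 2 M (simple_extension M c)"
    using dimension_simple_extension_square_root[OF M assms(5) _ False] by blast
  then have "pyth_tower R K (simple_extension M c)"
    using pyth_tower.step[OF assms(1,3-6)] by blast
  then show ?thesis
    using that simple_extension_incl[OF subfieldE(3)[OF M] assms(5)]
      simple_extension_mem[OF subfieldE(1)[OF M] assms(5)] by blast
qed

text \<open>The roots adjoined in the second tower are adjoined one by one on top of
  \<open>M1\<close>. Directedness is what makes the union of all towers a field.\<close>

lemma pyth_tower_directed:
  assumes "pyth_tower R K M1" "pyth_tower R K M2" "subfield K R"
  obtains M where "pyth_tower R K M" "M1 \<subseteq> M" "M2 \<subseteq> M"
proof -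
  have "\<exists>M. pyth_tower R K M \<and> M1 \<subseteq> M \<and> M2 \<subseteq> M"
    using assms(2)
  proof (induction rule: pyth_tower.induct)
    case base
    then show ?case using assms(1) pyth_tower_subfield(2)[OF assms(1,3)] by blast
  next
    case (step N a b c)
    then obtain M where M: "pyth_tower R K M" "M1 \<subseteq> M" "N \<subseteq> M" by blast
    then obtain M' where M': "pyth_tower R K M'" "M \<subseteq> M'" "c \<in> M'"
      using pyth_tower_extend[OF M(1) assms(3) _ _ step.hyps(4,5)] step.hyps(2,3) by blast
    have "simple_extension N c \<subseteq> M'"
      using simple_extension_subring_incl[OF subfieldE(1)[OF pyth_tower_subfield(1)[OF M'(1) assms(3)]]]
        M(3) M'(2,3) by blast
    then show ?case using M M' by blast
  qed
  then show ?thesis using that by blast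
qed

lemma pyth_closure_directed:
  assumes "subfield K R" "x \<in> pyth_closure R K" "y \<in> pyth_closure R K"
  obtains M where "pyth_tower R K M" "x \<in> M" "y \<in> M"
proof -
  obtain M1 M2 where "pyth_tower R K M1" "x \<in> M1" "pyth_tower R K M2" "y \<in> M2"
    using assms(2,3) unfolding pyth_closure_def by blast
  then show ?thesis
    using pyth_tower_directed[OF _ _ assms(1)] that by (metis subsetD)
qed

lemma pyth_tower_incl: "pyth_tower R K M \<Longrightarrow> M \<subseteq> pyth_closure R K"
  unfolding pyth_closure_def by blast

lemma pyth_closure_subfield:
  assumes "subfield K R"
  shows "subfield (pyth_closure R K) R"
proof (rule subfieldI'[OF subringI])
  let ?P = "pyth_closure R K"
  show c: "?P \<subseteq> carrier R"
    using pyth_closure_minimal[OF carrier_is_subfield subfieldE(3)[OF assms]] by blast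
  show "\<one> \<in> ?P"
    using pyth_closure_incl[of K R] subringE(3)[OF subfieldE(1)[OF assms]] by blast
  fix x assume x: "x \<in> ?P"
  show "\<ominus> x \<in> ?P"
    using pyth_closure_directed[OF assms x x] pyth_tower_incl pyth_tower_subfield(1)[OF _ assms]
      subringE(5)[OF subfieldE(1)] by (metis subsetD)
  fix y assume y: "y \<in> ?P"
  obtain M where M: "pyth_tower R K M" "x \<in> M" "y \<in> M"
    using pyth_closure_directed[OF assms x y] .
  then show "x \<otimes> y \<in> ?P" "x \<oplus> y \<in> ?P"
    using pyth_tower_incl pyth_tower_subfield(1)[OF M(1) assms]
      subringE(6,7)[OF subfieldE(1)] by (metis subsetD)+
next
  fix x assume x: "x \<in> pyth_closure R K - {\<zero>}"
  then obtain M where M: "pyth_tower R K M" "x \<in> M"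
    using pyth_closure_directed[OF assms] by blast
  then have "inv x \<in> M"
    using x subfield_m_inv(1)[OF pyth_tower_subfield(1)[OF M(1) assms]] by blast
  then show "inv x \<in> pyth_closure R K" using pyth_tower_incl[OF M(1)] by blast
qed

lemma pyth_closure_sqrt:
  assumes "subfield K R" "a \<in> pyth_closure R K" "b \<in> pyth_closure R K" "c \<in> carrier R"
    "c \<otimes> c = a \<otimes> a \<oplus> b \<otimes> b"
  shows "c \<in> pyth_closure R K"
proof -
  obtain M where "pyth_tower R K M" "a \<in> M" "b \<in> M"
    using pyth_closure_directed[OF assms(1-3)] .
  then show ?thesis
    using pyth_tower_extend[OF _ assms(1) _ _ assms(4,5)] pyth_tower_incl by (metis subsetD)
qed

lemma pyth_closure_mono:
  assumes "subfield K' R" "K \<subseteq> pyth_closure R K'"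
  shows "pyth_closure R K \<subseteq> pyth_closure R K'"
  using pyth_closure_minimal[OF pyth_closure_subfield[OF assms(1)] assms(2)]
    pyth_closure_sqrt[OF assms(1)] by blast

lemma formally_real_pyth_tower:
  assumes "pyth_tower R K M" "subfield K R" "formally_real R K"
  shows "formally_real R M"
  using assms
proof (induction rule: pyth_tower.induct)
  case base
  then show ?case by simp
next
  case (step M a b c)
  note M = pyth_tower_subfield(1)[OF step.hyps(1) step.prems(1)]
  note sc = subfieldE(3)[OF M]
  have "is_sum_of_squares R M (c \<otimes> c)"
    using is_sum_of_squares_add_square[OF sc is_sum_of_squares_square[OF sc]] step.hyps by auto
  then show ?case
    using formally_real_simple_extension[OF M _ step.hyps(4)] step by blast
qed

text \<open>A sum of squares involves finitely many elements, so a representation of -1 in the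
  closure would live in one tower field.\<close>

lemma formally_real_pyth_closure:
  assumes "subfield K R" "formally_real R K"
  shows "formally_real R (pyth_closure R K)"
proof -
  have "\<exists>M. pyth_tower R K M \<and> is_sum_of_squares R M x"
    if "is_sum_of_squares R (pyth_closure R K) x" for x
    using that subfieldE(3)[OF pyth_closure_subfield[OF assms(1)]]
  proof (induction rule: is_sum_of_squares_induct)
    case zero
    then show ?case using pyth_tower.base is_sum_of_squares_zero by blast
  next
    case (add_square s a)
    then obtain M N where M: "pyth_tower R K M" "is_sum_of_squares R M s"
      and N: "pyth_tower R K N" "a \<in> N" unfolding pyth_closure_def by blast
    obtain M' where M': "pyth_tower R K M'" "M \<subseteq> M'" "N \<subseteq> M'"
      using pyth_tower_directed[OF M(1) N(1) assms(1)] .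
    have "is_sum_of_squares R M' (s \<oplus> a \<otimes> a)"
      using is_sum_of_squares_add_square[OF subfieldE(3)[OF pyth_tower_subfield(1)[OF M'(1) assms(1)]]]
        is_sum_of_squares_mono[OF M(2) M'(2)] M'(3) N(2) by blast
    then show ?case using M'(1) by blast
  qed
  then show ?thesis
    using formally_real_pyth_tower[OF _ assms] unfolding formally_real_def by blast
qed

end

section \<open>Existence of square roots and the pythagorean property of the closure\<close>

context algebraically_closed
begin

lemma exists_root_of_polynomial:
  assumes "p \<in> carrier (poly_ring L)" "degree p > 0"
  obtains x where "x \<in> carrier L" "eval p x = \<zero>"
proof -
  have "roots p \<noteq> {#}"
    using roots_over_carrier[OF assms(1)] assms(2) unfolding splitted_def by auto
  then obtain x where "x \<in># roots p" by blast
  then show ?thesis using roots_mem_iff_is_root[OF assms(1)] that unfolding is_root_def by blast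
qed

lemma exists_square_root:
  assumes "x \<in> carrier L"
  obtains c where "c \<in> carrier L" "c \<otimes> c = x"
proof -
  have "[\<one>, \<zero>, \<ominus> x] \<in> carrier (poly_ring L)"
    using assms unfolding univ_poly_def polynomial_def by auto
  then obtain c where c: "c \<in> carrier L" "eval [\<one>, \<zero>, \<ominus> x] c = \<zero>"
    using exists_root_of_polynomial by (metis length_Cons list.size(3) diff_Suc_1 zero_less_Suc)
  then have "\<one> \<otimes> (c \<otimes> c) \<oplus> (\<zero> \<otimes> c \<oplus> (\<ominus> x \<otimes> \<one> \<oplus> \<zero>)) = \<zero>"
    by (simp add: numeral_2_eq_2)
  moreover have "\<one> \<otimes> (c \<otimes> c) \<oplus> (\<zero> \<otimes> c \<oplus> (\<ominus> x \<otimes> \<one> \<oplus> \<zero>)) = c \<otimes> c \<ominus> x"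
    using c(1) assms by algebra
  ultimately have "c \<otimes> c \<ominus> x = \<zero>" by metis
  then have "c \<otimes> c = x" using c(1) assms r_right_minus_eq by blast
  then show ?thesis using that c(1) by blast
qed

text \<open>Roots of sums of two squares suffice for sums of any length: once s = y^2, the next sum
  s + a^2 = y^2 + a^2 has only two summands.\<close>

lemma sum_of_squares_has_root:
  assumes "subfield T L"
    and sqrt: "\<And>a b c. \<lbrakk> a \<in> T; b \<in> T; c \<in> carrier L; c \<otimes> c = a \<otimes> a \<oplus> b \<otimes> b \<rbrakk> \<Longrightarrow> c \<in> T"
    and "is_sum_of_squares L T x"
  shows "\<exists>y\<in>T. x = y \<otimes> y"
  using assms(3) subfieldE(3)[OF assms(1)]
proof (induction rule: is_sum_of_squares_induct)
  case zero
  have "\<zero> = \<zero> \<otimes> \<zero>" by simp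
  then show ?case using subringE(2)[OF subfieldE(1)[OF assms(1)]] by blast
next
  case (add_square s a)
  then obtain y where y: "y \<in> T" "s = y \<otimes> y" by blast
  have "s \<oplus> a \<otimes> a \<in> carrier L"
    using y add_square.hyps(2) subfieldE(3)[OF assms(1)] by auto
  then obtain c where "c \<in> carrier L" "c \<otimes> c = s \<oplus> a \<otimes> a" using exists_square_root by blast
  then show ?case using sqrt[OF y(1) add_square.hyps(2)] y(2) by metis
qed

lemma pythagorean_pyth_closure:
  assumes "subfield K L"
  shows "pythagorean L (pyth_closure L K)"
  unfolding pythagorean_def
  using sum_of_squares_has_root[OF pyth_closure_subfield[OF assms]] pyth_closure_sqrt[OF assms]
  by blast

lemma pyth_closure_sqrt_sum_of_squares:
  assumes "subfield K L" "is_sum_of_squares L (pyth_closure L K) (c \<otimes> c)" "c \<in> carrier L"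
  shows "c \<in> pyth_closure L K"
proof -
  note P = pyth_closure_subfield[OF assms(1)]
  obtain y where y: "y \<in> pyth_closure L K" "c \<otimes> c = y \<otimes> y"
    using pythagorean_pyth_closure[OF assms(1)] assms(2) unfolding pythagorean_def by blast
  then have "c = y \<or> c = \<ominus> y" using square_eq_imp[OF assms(3)] subfieldE(3)[OF P] by blast
  then show ?thesis using y(1) subringE(5)[OF subfieldE(1)[OF P]] by auto
qed

end

subsection \<open>Springer's theorem on odd degree extensions\<close>

context field
begin

text \<open>Over a formally real field the leading coefficients of squares cannot cancel, so a
  nonzero sum of squares of polynomials has even degree.\<close>

lemma sum_of_squares_poly_degree_step:
  assumes K: "subfield K R" and real: "formally_real R K"
    and s: "s \<in> carrier (K[X])"
      "s = [] \<or> even (degree s) \<and> degree s < 2 * m \<and> is_sum_of_squares R K (lead_coeff s)"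
    and p: "p \<in> carrier (K[X])" "p \<noteq> []" "length p \<le> m"
  defines "t \<equiv> s \<oplus>\<^bsub>K[X]\<^esub> p \<otimes>\<^bsub>K[X]\<^esub> p"
  shows "t \<noteq> [] \<and> even (degree t) \<and> degree t < 2 * m \<and> is_sum_of_squares R K (lead_coeff t)"
proof -
  note sr = subfieldE(1)[OF K] and sc = subfieldE(3)[OF K]
  let ?q = "p \<otimes>\<^bsub>K[X]\<^esub> p"
  have pp: "polynomial K p" "polynomial K s" using p(1) s(1) by (simp_all add: univ_poly_carrier)
  have q: "?q = poly_mult p p" by (simp add: univ_poly_mult)
  have qp: "polynomial K ?q" unfolding q using poly_mult_closed[OF sr pp(1) pp(1)] .
  have qd: "degree ?q = 2 * degree p" unfolding q using poly_mult_degree_eq[OF sr pp(1) pp(1)] p(2) by simp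
  have ql: "lead_coeff ?q = lead_coeff p \<otimes> lead_coeff p"
    unfolding q using poly_mult_lead_coeff[OF sr pp(1) pp(1) p(2) p(2)] .
  have qn: "?q \<noteq> []" unfolding q using poly_mult_integral[OF sr pp(1) pp(1)] p(2) by blast
  have lp: "lead_coeff p \<in> K" using pp(1) p(2) unfolding polynomial_def by auto
  have sq: "is_sum_of_squares R K (coeff ?q i)" if "i \<ge> degree ?q" for i
    using that is_sum_of_squares_square[OF sc lp] is_sum_of_squares_zero coeff_degree[of ?q i] ql
      lead_coeff_simp[OF qn] by (cases "i = degree ?q") auto
  have ss: "is_sum_of_squares R K (coeff s i)" if "i \<ge> degree s" for i
    using that s(2) is_sum_of_squares_zero coeff_degree[of s i] lead_coeff_simp[of s]
    by (cases "s = []"; cases "i = degree s") auto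
  \<comment> \<open>\<open>N\<close> treats equal and unequal degrees alike, and also
    \<open>s = []\<close>: at \<open>N\<close> both coefficients are sums of squares, and at least
    one of them is a nonzero leading coefficient.\<close>
  define N where "N = max (degree s) (degree ?q)"
  have t: "t = poly_add s ?q" unfolding t_def by (simp add: univ_poly_add)
  have tp: "polynomial K t" unfolding t using poly_add_closed[OF sr pp(2) qp] .
  have "coeff t N = coeff s N \<oplus> coeff ?q N"
    unfolding t using poly_add_coeff polynomial_in_carrier[OF sr] pp(2) qp by metis
  moreover have N: "is_sum_of_squares R K (coeff s N)" "is_sum_of_squares R K (coeff ?q N)"
    using ss sq unfolding N_def by auto
  moreover have "coeff s N \<noteq> \<zero> \<or> coeff ?q N \<noteq> \<zero>"
  proof (cases "s \<noteq> [] \<and> N = degree s")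
    case True
    then have "coeff s N = lead_coeff s" using lead_coeff_simp by simp
    moreover have "lead_coeff s \<noteq> \<zero>" using True pp(2) unfolding polynomial_def by auto
    ultimately show ?thesis by simp
  next
    case False
    then have "N = degree ?q" unfolding N_def by (cases "s = []") auto
    then have "coeff ?q N = lead_coeff ?q" using lead_coeff_simp[OF qn] by simp
    moreover have "lead_coeff ?q \<noteq> \<zero>" using qn qp unfolding polynomial_def by auto
    ultimately show ?thesis by simp
  qed
  ultimately have cN: "coeff t N \<noteq> \<zero>" "is_sum_of_squares R K (coeff t N)"
    using formally_real_sum_zero[OF K real N] is_sum_of_squares_add[OF sc N] by auto
  have "degree t \<le> N" unfolding t N_def using poly_add_degree .
  moreover have "N \<le> degree t" using coeff_degree[of t N] cN(1) by (meson not_le)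
  ultimately have dt: "degree t = N" by simp
  have tn: "t \<noteq> []" using cN(1) by auto
  have "even (degree s)" "degree s < 2 * m"
    using s(2) p(2,3) by (auto simp: Suc_le_eq[symmetric] neq_Nil_conv)
  moreover have "degree ?q < 2 * m" using qd p(2,3) by (cases p) auto
  ultimately have "even N" "N < 2 * m" using qd unfolding N_def by (auto simp: max_def)
  then show ?thesis using tn dt cN(2) lead_coeff_simp[OF tn] by simp
qed

text \<open>A nonzero polynomial of length at most \<open>m\<close> has degree at most m - 1, whence
  the strict bound \<open>2 * m\<close> for the squares; the leading coefficient is carried along
  only to drive the induction.\<close>

lemma sum_of_squares_poly_degree:
  assumes K: "subfield K R" and real: "formally_real R K"
    and "is_sum_of_squares (K[X]) {p \<in> carrier (K[X]). length p \<le> m} s"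
  shows "s \<in> carrier (K[X])"
    and "s = [] \<or> even (degree s) \<and> degree s < 2 * m \<and> is_sum_of_squares R K (lead_coeff s)"
proof -
  interpret UP: domain "K[X]" using univ_poly_is_domain[OF subfieldE(1)[OF K]] .
  show sc: "s \<in> carrier (K[X])"
    using UP.is_sum_of_squares_carrier[OF assms(3)] by blast
  have "{p \<in> carrier (K[X]). length p \<le> m} \<subseteq> carrier (K[X])" by blast
  with assms(3)
  show "s = [] \<or> even (degree s) \<and> degree s < 2 * m \<and> is_sum_of_squares R K (lead_coeff s)"
  proof (induction rule: UP.is_sum_of_squares_induct)
    case zero
    then show ?case by (simp add: univ_poly_zero)
  next
    case (add_square s p)
    have s: "s \<in> carrier (K[X])"
      using UP.is_sum_of_squares_carrier[OF add_square.hyps(1)] by blast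
    show ?case
    proof (cases "p = []")
      case True
      then have "p = \<zero>\<^bsub>K[X]\<^esub>" by (simp add: univ_poly_zero)
      then have "s \<oplus>\<^bsub>K[X]\<^esub> p \<otimes>\<^bsub>K[X]\<^esub> p = s" using s by simp
      then show ?thesis using add_square.IH by simp
    next
      case False
      then show ?thesis
        using sum_of_squares_poly_degree_step[OF K real s add_square.IH _ False] add_square.hyps(2)
        by blast
    qed
  qed
qed

text \<open>Each summand \<open>p\<close> is replaced by its remainder r modulo \<open>f\<close>;
  the change p^2 - r^2 = (p - r)(p + r) is a multiple of \<open>f\<close>.\<close>

lemma sum_of_squares_poly_reduce:
  assumes K: "subfield K R" and f: "f \<in> carrier (K[X])" "degree f > 0"
    and "is_sum_of_squares (K[X]) (carrier (K[X])) s"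
  obtains s' where "is_sum_of_squares (K[X]) {p \<in> carrier (K[X]). length p \<le> degree f} s'"
    "f divides\<^bsub>K[X]\<^esub> (s \<ominus>\<^bsub>K[X]\<^esub> s')"
proof -
  interpret UP: domain "K[X]" using univ_poly_is_domain[OF subfieldE(1)[OF K]] .
  let ?S = "{p \<in> carrier (K[X]). length p \<le> degree f}"
  have "\<exists>s'. is_sum_of_squares (K[X]) ?S s' \<and> f divides\<^bsub>K[X]\<^esub> (s \<ominus>\<^bsub>K[X]\<^esub> s')"
    using assms(4) subset_refl
  proof (induction rule: UP.is_sum_of_squares_induct)
    case zero
    have "f divides\<^bsub>K[X]\<^esub> (\<zero>\<^bsub>K[X]\<^esub> \<ominus>\<^bsub>K[X]\<^esub> \<zero>\<^bsub>K[X]\<^esub>)"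
      unfolding factor_def using f(1) UP.r_null[of f] by (metis UP.r_right_minus_eq UP.zero_closed)
    then show ?case using UP.is_sum_of_squares_zero by blast
  next
    case (add_square s p)
    then obtain s' where s': "is_sum_of_squares (K[X]) ?S s'" "f divides\<^bsub>K[X]\<^esub> (s \<ominus>\<^bsub>K[X]\<^esub> s')"
      by blast
    then obtain u where u: "u \<in> carrier (K[X])" "s \<ominus>\<^bsub>K[X]\<^esub> s' = f \<otimes>\<^bsub>K[X]\<^esub> u"
      unfolding factor_def by blast
    let ?r = "p pmod f" and ?q = "p pdiv f"
    have fn: "f \<noteq> []" using f(2) by auto
    note p = add_square.hyps(2)
    have c: "?r \<in> carrier (K[X])" "?q \<in> carrier (K[X])"
      using long_division_closed[OF K p f(1)] by auto
    have r: "?r \<in> ?S" using c pmod_degree[OF K p f(1) fn] f(2) by (cases ?r) auto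
    have pe: "p = f \<otimes>\<^bsub>K[X]\<^esub> ?q \<oplus>\<^bsub>K[X]\<^esub> ?r" using pdiv_pmod[OF K p f(1)] .
    have sc: "s \<in> carrier (K[X])" "s' \<in> carrier (K[X])"
      using UP.is_sum_of_squares_carrier[OF add_square.hyps(1)] UP.is_sum_of_squares_carrier[OF s'(1)]
      by auto
    have "(s \<oplus>\<^bsub>K[X]\<^esub> p \<otimes>\<^bsub>K[X]\<^esub> p) \<ominus>\<^bsub>K[X]\<^esub> (s' \<oplus>\<^bsub>K[X]\<^esub> ?r \<otimes>\<^bsub>K[X]\<^esub> ?r)
      = (s \<ominus>\<^bsub>K[X]\<^esub> s') \<oplus>\<^bsub>K[X]\<^esub> (p \<ominus>\<^bsub>K[X]\<^esub> ?r) \<otimes>\<^bsub>K[X]\<^esub> (p \<oplus>\<^bsub>K[X]\<^esub> ?r)"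
      using sc c p by algebra
    also have "p \<ominus>\<^bsub>K[X]\<^esub> ?r = f \<otimes>\<^bsub>K[X]\<^esub> ?q"
    proof -
      have "(f \<otimes>\<^bsub>K[X]\<^esub> ?q \<oplus>\<^bsub>K[X]\<^esub> ?r) \<ominus>\<^bsub>K[X]\<^esub> ?r = f \<otimes>\<^bsub>K[X]\<^esub> ?q"
        using c f(1) by algebra
      then show ?thesis using pe by simp
    qed
    also have "(s \<ominus>\<^bsub>K[X]\<^esub> s') \<oplus>\<^bsub>K[X]\<^esub> (f \<otimes>\<^bsub>K[X]\<^esub> ?q) \<otimes>\<^bsub>K[X]\<^esub> (p \<oplus>\<^bsub>K[X]\<^esub> ?r)
      = f \<otimes>\<^bsub>K[X]\<^esub> (u \<oplus>\<^bsub>K[X]\<^esub> ?q \<otimes>\<^bsub>K[X]\<^esub> (p \<oplus>\<^bsub>K[X]\<^esub> ?r))"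
      unfolding u(2) using u(1) c p f(1) by algebra
    finally have "f divides\<^bsub>K[X]\<^esub> ((s \<oplus>\<^bsub>K[X]\<^esub> p \<otimes>\<^bsub>K[X]\<^esub> p) \<ominus>\<^bsub>K[X]\<^esub> (s' \<oplus>\<^bsub>K[X]\<^esub> ?r \<otimes>\<^bsub>K[X]\<^esub> ?r))"
      unfolding factor_def using u(1) c p by blast
    moreover have "is_sum_of_squares (K[X]) ?S (s' \<oplus>\<^bsub>K[X]\<^esub> ?r \<otimes>\<^bsub>K[X]\<^esub> ?r)"
      by (rule UP.is_sum_of_squares_add_square[OF _ s'(1) r]) blast
    ultimately show ?case by blast
  qed
  then show ?thesis using that by blast
qed

text \<open>Springer's argument: after reducing the summands modulo \<open>f\<close>, the cofactor of \<open>f\<close> in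
  \<open>1 + s\<close> has odd degree smaller than that of \<open>f\<close>.\<close>

lemma odd_degree_not_divides_one_plus_sum_of_squares:
  assumes K: "subfield K R" and real: "formally_real R K"
    and "f \<in> carrier (K[X])" "odd (degree f)" "is_sum_of_squares (K[X]) (carrier (K[X])) s"
  shows "\<not> f divides\<^bsub>K[X]\<^esub> (s \<oplus>\<^bsub>K[X]\<^esub> \<one>\<^bsub>K[X]\<^esub>)"
  using assms(3-5)
proof (induction "degree f" arbitrary: f s rule: less_induct)
  case less
  interpret UP: domain "K[X]" using univ_poly_is_domain[OF subfieldE(1)[OF K]] .
  note sr = subfieldE(1)[OF K]
  show ?case
  proof
    assume div: "f divides\<^bsub>K[X]\<^esub> (s \<oplus>\<^bsub>K[X]\<^esub> \<one>\<^bsub>K[X]\<^esub>)"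
    let ?S = "{p \<in> carrier (K[X]). length p \<le> degree f}"
    have pos: "degree f > 0" using less.prems(2) by (rule odd_pos)
    obtain s' where s': "is_sum_of_squares (K[X]) ?S s'" "f divides\<^bsub>K[X]\<^esub> (s \<ominus>\<^bsub>K[X]\<^esub> s')"
      using sum_of_squares_poly_reduce[OF K less.prems(1) pos less.prems(3)] .
    have sc: "s \<in> carrier (K[X])" "s' \<in> carrier (K[X])"
      using UP.is_sum_of_squares_carrier[OF less.prems(3)] UP.is_sum_of_squares_carrier[OF s'(1)]
      by auto
    obtain u v where uv: "u \<in> carrier (K[X])" "s \<oplus>\<^bsub>K[X]\<^esub> \<one>\<^bsub>K[X]\<^esub> = f \<otimes>\<^bsub>K[X]\<^esub> u"
      "v \<in> carrier (K[X])" "s \<ominus>\<^bsub>K[X]\<^esub> s' = f \<otimes>\<^bsub>K[X]\<^esub> v"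
      using div s'(2) unfolding factor_def by blast
    \<comment> \<open>The summand 1 is written as the square of a nonzero polynomial, so the degree
      step also yields that \<open>t\<close> is nonzero, whatever \<open>s'\<close> is.\<close>
    define t where "t = s' \<oplus>\<^bsub>K[X]\<^esub> \<one>\<^bsub>K[X]\<^esub> \<otimes>\<^bsub>K[X]\<^esub> \<one>\<^bsub>K[X]\<^esub>"
    have one: "\<one>\<^bsub>K[X]\<^esub> \<noteq> []" "length \<one>\<^bsub>K[X]\<^esub> \<le> degree f"
      using pos by (auto simp: univ_poly_one)
    have t: "t \<noteq> []" "even (degree t)" "degree t < 2 * degree f"
      using sum_of_squares_poly_degree_step[OF K real sum_of_squares_poly_degree[OF K real s'(1)]
          UP.one_closed one] unfolding t_def by blast+
    define q where "q = u \<ominus>\<^bsub>K[X]\<^esub> v"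
    have q: "q \<in> carrier (K[X])" unfolding q_def using uv by simp
    have "t = (s \<oplus>\<^bsub>K[X]\<^esub> \<one>\<^bsub>K[X]\<^esub>) \<ominus>\<^bsub>K[X]\<^esub> (s \<ominus>\<^bsub>K[X]\<^esub> s')"
      unfolding t_def using sc by algebra
    also have "\<dots> = f \<otimes>\<^bsub>K[X]\<^esub> q"
      unfolding uv(2,4) q_def using uv(1,3) less.prems(1) by algebra
    finally have tq: "t = f \<otimes>\<^bsub>K[X]\<^esub> q" .
    have qn: "q \<noteq> []" "f \<noteq> []"
      using tq t(1) UP.r_null[OF less.prems(1)] pos by (auto simp: univ_poly_zero)
    have "degree t = degree f + degree q"
      unfolding tq using poly_mult_degree_eq[OF sr, of f q] less.prems(1) q qn
      by (simp add: univ_poly_mult univ_poly_carrier)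
    then have dq: "degree q < degree f" "odd (degree q)" using t less.prems(2) by auto
    have "is_sum_of_squares (K[X]) (carrier (K[X])) s'"
      using UP.is_sum_of_squares_mono[OF s'(1)] by blast
    moreover have "q divides\<^bsub>K[X]\<^esub> (s' \<oplus>\<^bsub>K[X]\<^esub> \<one>\<^bsub>K[X]\<^esub>)"
    proof -
      have "s' \<oplus>\<^bsub>K[X]\<^esub> \<one>\<^bsub>K[X]\<^esub> = q \<otimes>\<^bsub>K[X]\<^esub> f"
        using tq sc q less.prems(1) unfolding t_def by (simp add: UP.m_comm)
      then show ?thesis unfolding factor_def using less.prems(1) by blast
    qed
    ultimately show False using less.hyps[OF dq(1) q dq(2)] by blast
  qed
qed

text \<open>Evaluation at \<open>x\<close> maps \<open>K[X]\<close> onto the extension, so a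
  representation of -1 lifts to a sum of squares s of polynomials with s + 1 vanishing at
  \<open>x\<close>. Then the minimal polynomial of \<open>x\<close>, of odd degree, divides s +
  1.\<close>

lemma formally_real_odd_simple_extension:
  assumes K: "subfield K R" and real: "formally_real R K"
    and x: "x \<in> carrier R" "(algebraic over K) x" "odd (degree (Irr K x))"
  shows "formally_real R (simple_extension K x)"
proof (rule ccontr)
  note sr = subfieldE(1)[OF K] and sc = subfieldE(3)[OF K]
  interpret UP: domain "K[X]" using univ_poly_is_domain[OF sr] .
  interpret ev: ring_hom_ring "K[X]" R "\<lambda>p. eval p x" using eval_ring_hom[OF sr x(1)] .
  have lift: "\<exists>s. is_sum_of_squares (K[X]) (carrier (K[X])) s \<and> eval s x = y"
    if "is_sum_of_squares R (simple_extension K x) y" for y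
    using that simple_extension_in_carrier[OF sc x(1)]
  proof (induction rule: is_sum_of_squares_induct)
    case zero
    then show ?case using UP.is_sum_of_squares_zero ev.hom_zero by blast
  next
    case (add_square y a)
    then obtain s p where s: "is_sum_of_squares (K[X]) (carrier (K[X])) s" "eval s x = y"
      and p: "p \<in> carrier (K[X])" "a = eval p x"
      unfolding simple_extension_as_eval_img[OF sc x(1)] by blast
    have "s \<in> carrier (K[X])" using UP.is_sum_of_squares_carrier[OF s(1)] by blast
    then have "eval (s \<oplus>\<^bsub>K[X]\<^esub> p \<otimes>\<^bsub>K[X]\<^esub> p) x = y \<oplus> a \<otimes> a" using s(2) p by simp
    then show ?case using UP.is_sum_of_squares_add_square[OF _ s(1) p(1)] by blast
  qed
  assume "\<not> ?thesis"
  then obtain s where s: "is_sum_of_squares (K[X]) (carrier (K[X])) s" "eval s x = \<ominus> \<one>"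
    using lift unfolding formally_real_def by blast
  have sk: "s \<in> carrier (K[X])" using UP.is_sum_of_squares_carrier[OF s(1)] by blast
  have c: "s \<oplus>\<^bsub>K[X]\<^esub> \<one>\<^bsub>K[X]\<^esub> \<in> carrier (K[X])" using sk by simp
  have "eval (s \<oplus>\<^bsub>K[X]\<^esub> \<one>\<^bsub>K[X]\<^esub>) x = eval s x \<oplus> eval \<one>\<^bsub>K[X]\<^esub> x" using sk by simp
  also have "\<dots> = \<zero>" using s(2) ev.hom_one by (simp add: l_neg)
  finally have "Irr K x divides\<^bsub>K[X]\<^esub> (s \<oplus>\<^bsub>K[X]\<^esub> \<one>\<^bsub>K[X]\<^esub>)"
    using Irr_minimal[OF K x(1,2) c] pdivides_iff_shell[OF K IrrE(1)[OF K x(1,2)] c] by blast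
  then show False
    using odd_degree_not_divides_one_plus_sum_of_squares[OF K real IrrE(1)[OF K x(1,2)] x(3) s(1)]
    by blast
qed

end

context algebraically_closed
begin

text \<open>Some irreducible factor of a polynomial of odd degree has odd degree. It is found by
  dividing out the minimal polynomial of a root as long as that has even degree, which leaves a
  cofactor of smaller odd degree.\<close>

lemma odd_degree_exists_odd_root:
  assumes K: "subfield K L" and "f \<in> carrier (K[X])" "odd (degree f)"
  shows "\<exists>x\<in>carrier L. eval f x = \<zero> \<and> (algebraic over K) x \<and> odd (degree (Irr K x))"
  using assms(2,3)
proof (induction "degree f" arbitrary: f rule: less_induct)
  case less
  note sr = subfieldE(1)[OF K]
  interpret UP: domain "K[X]" using univ_poly_is_domain[OF sr] .
  have pos: "degree f > 0" using less.prems(2) by (rule odd_pos)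
  obtain x where x: "x \<in> carrier L" "eval f x = \<zero>"
    using exists_root_of_polynomial[OF carrier_polynomial_shell[OF sr less.prems(1)] pos] .
  have fn: "f \<noteq> []" using pos by auto
  have alg: "(algebraic over K) x" using algebraicI[OF less.prems(1) fn x(2)] .
  show ?case
  proof (cases "odd (degree (Irr K x))")
    case True
    then show ?thesis using x alg by blast
  next
    case False
    let ?g = "Irr K x"
    have g: "?g \<in> carrier (K[X])" using IrrE(1)[OF K x(1) alg] .
    have "?g divides\<^bsub>K[X]\<^esub> f"
      using Irr_minimal[OF K x(1) alg less.prems(1) x(2)] pdivides_iff_shell[OF K g less.prems(1)]
      by blast
    then obtain q where q: "q \<in> carrier (K[X])" "f = ?g \<otimes>\<^bsub>K[X]\<^esub> q" unfolding factor_def by blast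
    have n: "q \<noteq> []" "?g \<noteq> []"
      using q(2) fn UP.r_null[OF g] UP.l_null[OF q(1)] by (auto simp: univ_poly_zero)
    have "degree f = degree ?g + degree q"
      using poly_mult_degree_eq[OF sr, of ?g q] q g n
      by (simp add: univ_poly_mult univ_poly_carrier)
    moreover have "degree ?g \<ge> 1" using pirreducible_degree[OF K g IrrE(2)[OF K x(1) alg]] .
    ultimately have "degree q < degree f" "odd (degree q)" using False less.prems(2) by auto
    then obtain y where y: "y \<in> carrier L" "eval q y = \<zero>" "(algebraic over K) y"
      "odd (degree (Irr K y))" using less.hyps[OF _ q(1)] by blast
    interpret ev: ring_hom_ring "K[X]" L "\<lambda>p. eval p y" using eval_ring_hom[OF sr y(1)] .
    have "eval f y = eval ?g y \<otimes> eval q y"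
      by (subst q(2)) (rule ev.hom_mult[OF g q(1)])
    then have "eval f y = \<zero>" using y(2) ev.hom_closed[OF g] by simp
    then show ?thesis using y by blast
  qed
qed

end

subsection \<open>Extensions of odd prime degree\<close>

context field
begin

lemma Span_one:
  assumes "subfield K R"
  shows "independent K [\<one>]" and "Span K [\<one>] = K"
proof -
  show one: "independent K [\<one>]"
    by (rule li_Cons) (auto)
  show "Span K [\<one>] = K"
    using independent_length_eq_dimension[OF assms dimension_one[OF assms] one]
      subringE(3)[OF subfieldE(1)[OF assms]] by simp
qed

lemma dimension_one_eq:
  assumes "subfield K R" "subfield M R" "K \<subseteq> M" "dimension 1 K M"
  shows "M = K"
  using independent_length_eq_dimension[OF assms(1,4) Span_one(1)[OF assms(1)]]
    Span_one(2)[OF assms(1)] subringE(3)[OF subfieldE(1)[OF assms(2)]] by simp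

lemma dimension_subspace_eq:
  assumes "subfield K R" "dimension n K U" "dimension n K V" "U \<subseteq> V"
  shows "U = V"
proof -
  obtain Us where "set Us \<subseteq> carrier R" "independent K Us" "length Us = n" "Span K Us = U"
    using exists_base[OF assms(1,2)] by blast
  then show ?thesis
    using independent_length_eq_dimension[OF assms(1,3)] Span_base_incl[OF assms(1)] assms(4)
    by blast
qed

lemma Span_subset_subring:
  assumes "subfield K R" "subring M R" "K \<subseteq> M" "set Us \<subseteq> M"
  shows "Span K Us \<subseteq> M"
  using assms(4)
proof (induction Us)
  case Nil
  then show ?case using subringE(2)[OF assms(2)] by simp
next
  case (Cons u Us)
  show ?case
  proof
    fix x assume "x \<in> Span K (u # Us)"
    then obtain k v where "k \<in> K" "v \<in> Span K Us" "x = k \<otimes> u \<oplus> v"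
      using line_extension_mem_iff by auto
    moreover have "Span K Us \<subseteq> M" "u \<in> M" using Cons by auto
    ultimately show "x \<in> M" using assms(3) subringE(6,7)[OF assms(2)] by blast
  qed
qed

lemma Span_mono_field:
  assumes "K \<subseteq> K'"
  shows "Span K Us \<subseteq> Span K' Us"
proof (induction Us)
  case (Cons u Us)
  then show ?case using assms line_extension_mem_iff by (simp add: subset_iff) blast
qed simp

text \<open>The degree of \<open>x\<close> divides the prime \<open>p\<close> by the tower formula
  and is not 1 because \<open>x\<close> lies outside \<open>E\<close>.\<close>

lemma prime_degree_simple_extension:
  assumes E: "subfield E R" and F: "subfield F R" "E \<subseteq> F"
    and p: "prime p" "dimension p E F" and x: "x \<in> F" "x \<notin> E"
  shows "(algebraic over E) x" and "simple_extension E x = F" and "degree (Irr E x) = p"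
proof -
  have xc: "x \<in> carrier R" using x subfieldE(3)[OF F(1)] by blast
  show alg: "(algebraic over E) x"
    using finite_dimension_imp_algebraic[OF E subfieldE(1)[OF F(1)] finite_dimensionI[OF p(2)] x(1)] .
  let ?S = "simple_extension E x"
  have S: "subfield ?S R" using simple_extension_is_subfield[OF E xc] alg by simp
  have SF: "?S \<subseteq> F" using simple_extension_subring_incl[OF subfieldE(1)[OF F(1)] F(2) x(1)] .
  have ES: "E \<subseteq> ?S" using simple_extension_incl[OF subfieldE(3)[OF E] xc] .
  have dS: "dimension (degree (Irr E x)) E ?S" using dimension_simple_extension[OF E xc alg] .
  obtain Us where Us: "set Us \<subseteq> carrier R" "independent E Us" "length Us = p" "Span E Us = F"
    using exists_base[OF E p(2)] by blast
  \<comment> \<open>A basis of \<open>F\<close> over \<open>E\<close> still spans \<open>F\<close>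
    over the intermediate field, which makes the upper degree finite.\<close>
  have "set Us \<subseteq> F" using Span_base_incl[OF E Us(1)] Us(4) by simp
  then have "Span ?S Us = F"
    using Span_subset_subring[OF S subfieldE(1)[OF F(1)] SF] Span_mono_field[OF ES, of Us] Us(4)
    by blast
  then obtain m where m: "dimension m ?S F"
    using Span_finite_dimension[OF S Us(1)] by auto
  have "degree (Irr E x) * m = p"
    using dimension_is_inj[OF E telescopic_base[OF E S dS m] p(2)] .
  moreover have "degree (Irr E x) \<noteq> 1"
  proof
    assume "degree (Irr E x) = 1"
    then have "?S = E" using dimension_one_eq[OF E S ES] dS by simp
    then show False using simple_extension_mem[OF subfieldE(1)[OF E] xc] x(2) by simp
  qed
  ultimately show deg: "degree (Irr E x) = p"
    using p(1) by (metis dvd_triv_left prime_nat_iff)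
  show "?S = F" using dimension_subspace_eq[OF E _ p(2) SF] dS deg by simp
qed

lemma Irr_eqI:
  assumes "subfield K R" "x \<in> carrier R" "(algebraic over K) x" "y \<in> carrier R"
    "eval (Irr K x) y = \<zero>"
  shows "(algebraic over K) y" and "Irr K y = Irr K x"
proof -
  note I = IrrE[OF assms(1-3)]
  have "Irr K x \<noteq> []"
    using pirreducibleE(1)[OF subfieldE(1)[OF assms(1)] I(1,2)] .
  then show alg: "(algebraic over K) y" by (intro algebraicI[OF I(1) _ assms(5)])
  show "Irr K y = Irr K x"
    unfolding Irr_def[of K y]
    using I assms(5) by (intro the1_equality[OF minimal_polynomial_is_unique[OF assms(1,4) alg]]) simp
qed

lemma degree_Irr_mem:
  assumes "subfield K R" "x \<in> K"
  shows "degree (Irr K x) = 1"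
proof -
  note sr = subfieldE(1)[OF assms(1)]
  have x: "x \<in> carrier R" using assms subfieldE(3) by blast
  have "simple_extension K x = K"
    using simple_extension_incl[OF subfieldE(3)[OF assms(1)] x]
      simple_extension_subring_incl[OF sr subset_refl assms(2)] by blast
  then have "dimension (degree (Irr K x)) K K"
    using dimension_simple_extension[OF assms(1) x algebraic_self[OF sr assms(2)]] by simp
  then show ?thesis using dimension_is_inj[OF assms(1) _ dimension_one[OF assms(1)]] by blast
qed

text \<open>The identity e = ((e + 1)/2)^2 - ((e - 1)/2)^2 turns a representation of -1 into one of
  \<open>e\<close>.\<close>

lemma not_formally_real_is_sum_of_squares:
  assumes "subfield K R" "\<not> formally_real R K" "\<one> \<oplus> \<one> \<noteq> \<zero>" "e \<in> K"
  shows "is_sum_of_squares R K e"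
proof -
  note sr = subfieldE(1)[OF assms(1)] and sc = subfieldE(3)[OF assms(1)]
  have two: "\<one> \<oplus> \<one> \<in> K - {\<zero>}" using subringE(3,7)[OF sr] assms(3) by simp
  define h where "h = inv (\<one> \<oplus> \<one>)"
  have h: "h \<in> K" "(\<one> \<oplus> \<one>) \<otimes> h = \<one>" using subfield_m_inv[OF assms(1) two] unfolding h_def by auto
  have c: "h \<in> carrier R" "e \<in> carrier R" using h assms(4) sc by auto
  have hh: "h \<oplus> h = \<one>" using h(2) c by (simp add: l_distr)
  let ?u = "(e \<oplus> \<one>) \<otimes> h" and ?v = "(e \<ominus> \<one>) \<otimes> h"
  have uv: "?u \<in> K" "?v \<in> K"
    using h(1) assms(4) subringE(3,5,6,7)[OF sr] unfolding a_minus_def by auto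
  have "?v \<otimes> ?v \<otimes> (\<ominus> \<one>) \<oplus> ?u \<otimes> ?u = e \<otimes> ((h \<oplus> h) \<otimes> (h \<oplus> h))"
    using c by algebra
  then have "?v \<otimes> ?v \<otimes> (\<ominus> \<one>) \<oplus> ?u \<otimes> ?u = e" using hh c by simp
  then show ?thesis
    using is_sum_of_squares_add_square[OF sc is_sum_of_squares_mult_square[OF sr _ uv(2)] uv(1)]
      assms(2) unfolding formally_real_def by metis
qed

text \<open>From -1 = A - eB with sums of squares \<open>A\<close> and \<open>B\<close>, reality of
  \<open>K\<close> gives a nonzero \<open>B\<close>, and then e = (A + 1)/B would be a sum of
  squares.\<close>

lemma formally_real_simple_extension_neg:
  assumes K: "subfield K R" and real: "formally_real R K"
    and e: "e \<in> K" "\<not> is_sum_of_squares R K e"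
    and w: "w \<in> carrier R" "w \<otimes> w = \<ominus> e"
  shows "formally_real R (simple_extension K w)"
proof (rule ccontr)
  note sr = subfieldE(1)[OF K] and sc = subfieldE(3)[OF K]
  have ww: "w \<otimes> w \<in> K" using w e(1) subringE(5)[OF sr] by simp
  assume "\<not> ?thesis"
  then obtain A B where AB: "is_sum_of_squares R K A" "is_sum_of_squares R K B"
    "\<ominus> \<one> = A \<oplus> (w \<otimes> w) \<otimes> B"
    using minus_one_sum_of_squares_simple_extension[OF K real w(1) ww] by blast
  have c: "A \<in> carrier R" "B \<in> carrier R" "e \<in> carrier R"
    using is_sum_of_squares_carrier[OF AB(1) sc] is_sum_of_squares_carrier[OF AB(2) sc] e sc by auto
  have Bn: "B \<noteq> \<zero>"
  proof
    assume "B = \<zero>"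
    then have "\<ominus> \<one> = A" using AB(3) c w by simp
    then show False using AB(1) real unfolding formally_real_def by simp
  qed
  have "A \<oplus> \<one> \<otimes> \<one> = e \<otimes> B"
  proof -
    have "\<zero> = \<one> \<oplus> (A \<oplus> (\<ominus> e) \<otimes> B)" using AB(3) unfolding w(2) by (metis one_closed r_neg)
    also have "\<dots> = (A \<oplus> \<one> \<otimes> \<one>) \<ominus> e \<otimes> B" using c by algebra
    finally have "(A \<oplus> \<one> \<otimes> \<one>) \<ominus> e \<otimes> B = \<zero>" by simp
    then show ?thesis using c r_right_minus_eq by (metis a_closed m_closed one_closed)
  qed
  moreover have "is_sum_of_squares R K (A \<oplus> \<one> \<otimes> \<one>)"
    using is_sum_of_squares_add_square[OF sc AB(1) subringE(3)[OF sr]] .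
  ultimately have "is_sum_of_squares R K (e \<otimes> B \<otimes> inv B)"
    using sum_of_squares_div[OF K _ AB(2) Bn] by simp
  then show False using e(2) c Bn field_Units by (simp add: m_assoc)
qed

end

section \<open>Reality over the given Galois extension of odd prime degree\<close>

locale odd_prime_galois = algebraically_closed L for L (structure) +
  fixes E F :: "'a set" and p :: nat
  assumes prime_p: "prime p" and odd_p: "odd p"
    and galois: "galois_extension L E F"
    and dim_p: "dimension p E F"
begin

lemma E: "subfield E L" and F: "subfield F L" and E_F: "E \<subseteq> F"
  using galois unfolding galois_extension_def normal_extension_def algebraic_extension_def
    field_extension_def by auto

lemma root_Irr_mem:
  assumes "x \<in> F" "y \<in> carrier L" "eval (Irr E x) y = \<zero>"
  shows "y \<in> F"
proof -
  have "x \<in> carrier L" "(algebraic over E) x"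
    using assms(1) subfieldE(3)[OF F] galois
    unfolding galois_extension_def normal_extension_def algebraic_extension_def by auto
  then have "Irr E x \<noteq> []"
    using pirreducibleE(1)[OF subfieldE(1)[OF E]] IrrE(1,2)[OF E] by blast
  then show ?thesis
    using galois assms unfolding galois_extension_def normal_extension_def is_root_def by blast
qed

lemma exists_generator: obtains x where "x \<in> F" "x \<notin> E"
proof -
  have "E \<noteq> F"
    using dimension_is_inj[OF E dim_p] dimension_one[OF E] prime_p by (metis not_prime_1)
  then show ?thesis using that E_F by blast
qed

lemmas generator = prime_degree_simple_extension[OF E F E_F prime_p dim_p]

text \<open>Over \<open>K\<close> the minimal polynomial of a generator of \<open>F\<close> may
  factor, but it has a root \<open>y\<close> of odd degree over \<open>K\<close>. Normality puts
  \<open>y\<close> into \<open>F\<close>, and having degree \<open>p\<close> over \<open>E\<close>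
  it generates \<open>F\<close>. So \<open>K(y)\<close> contains \<open>F\<close>, and Springer's
  theorem applies to it.\<close>

lemma formally_real_compositum:
  assumes K: "subfield K L" "E \<subseteq> K" and real: "formally_real L K"
  obtains M where "subfield M L" "K \<subseteq> M" "F \<subseteq> M" "formally_real L M"
proof -
  obtain x where x: "x \<in> F" "x \<notin> E" using exists_generator .
  have xc: "x \<in> carrier L" using x subfieldE(3)[OF F] by blast
  note g = generator[OF x]
  have "Irr E x \<in> carrier (E[X])" using IrrE(1)[OF E xc g(1)] .
  then have "Irr E x \<in> carrier (K[X])"
    using K(2) unfolding univ_poly_def polynomial_def by auto
  then obtain y where y: "y \<in> carrier L" "eval (Irr E x) y = \<zero>" "(algebraic over K) y"
    "odd (degree (Irr K y))"
    using odd_degree_exists_odd_root[OF K(1)] g(3) odd_p by metis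
  have yF: "y \<in> F" using root_Irr_mem[OF x(1) y(1,2)] .
  have "degree (Irr E y) = p" using Irr_eqI(2)[OF E xc g(1) y(1,2)] g(3) by simp
  then have "y \<notin> E" using degree_Irr_mem[OF E] prime_p by (metis not_prime_1)
  then have "F \<subseteq> simple_extension K y"
    using generator(2)[OF yF] mono_simple_extension[OF K(2)] by blast
  then show ?thesis
    using that simple_extension_is_subfield[OF K(1) y(1)] y(3)
      simple_extension_incl[OF subfieldE(3)[OF K(1)] y(1)]
      formally_real_odd_simple_extension[OF K(1) real y(1,3,4)] by blast
qed

text \<open>If \<open>K\<close> is real and v^2 is not a sum of squares in it, then adjoining w with
  w^2 = -v^2 keeps the field real. Enlarging it to contain \<open>F\<close> and passing to the
  pythagorean closure keeps it real as well, but that closure contains both v and w, with v^2 + w^2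
  = 0. If \<open>K\<close> is not real, all its elements are sums of squares.\<close>

lemma square_in_pyth_closure_is_sum_of_squares:
  assumes K: "subfield K L" "E \<subseteq> K" and two: "\<one> \<oplus> \<one> \<noteq> \<zero>"
    and v: "v \<in> pyth_closure L F" "v \<otimes> v \<in> K"
  shows "is_sum_of_squares L K (v \<otimes> v)"
proof (cases "formally_real L K")
  case False
  then show ?thesis using not_formally_real_is_sum_of_squares[OF K(1) _ two v(2)] by blast
next
  case True
  note sr = subfieldE(1)[OF K(1)] and sc = subfieldE(3)[OF K(1)]
  show ?thesis
  proof (rule ccontr)
    assume neg: "\<not> ?thesis"
    have vc: "v \<in> carrier L" using v(1) subfieldE(3)[OF pyth_closure_subfield[OF F]] by blast
    obtain w where w: "w \<in> carrier L" "w \<otimes> w = \<ominus> (v \<otimes> v)"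
      using exists_square_root vc by (metis a_inv_closed m_closed)
    let ?K = "simple_extension K w"
    have "w \<otimes> w \<in> K" using w(2) subringE(5)[OF sr v(2)] by simp
    then have K': "subfield ?K L" using simple_extension_square_root_subfield[OF K(1) w(1)] by blast
    have E': "E \<subseteq> ?K" using simple_extension_incl[OF sc w(1)] K(2) by blast
    have real': "formally_real L ?K"
      using formally_real_simple_extension_neg[OF K(1) True v(2) neg w] .
    obtain M where M: "subfield M L" "?K \<subseteq> M" "F \<subseteq> M" "formally_real L M"
      by (rule formally_real_compositum[OF K' E' real'])
    note P = pyth_closure_subfield[OF M(1)]
    note pc = subfieldE(3)[OF P]
    have "F \<subseteq> pyth_closure L M" using M(3) pyth_closure_incl[of M L] by blast
    then have "v \<in> pyth_closure L M" using pyth_closure_mono[OF M(1)] v(1) by blast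
    moreover have "w \<in> pyth_closure L M"
      using simple_extension_mem[OF sr w(1)] M(2) pyth_closure_incl[of M L] by blast
    ultimately have "is_sum_of_squares L (pyth_closure L M) (w \<otimes> w)"
      "is_sum_of_squares L (pyth_closure L M) (v \<otimes> v)"
      by (simp_all add: is_sum_of_squares_square[OF pc])
    moreover have "w \<otimes> w \<oplus> v \<otimes> v = \<zero>" using w(2) vc by (simp add: l_neg)
    ultimately have "v \<otimes> v = \<zero>"
      using formally_real_sum_zero(2)[OF P formally_real_pyth_closure[OF M(1,4)]] by blast
    then show False using neg is_sum_of_squares_zero by simp
  qed
qed

end

subsection \<open>Fixed fields of an endomorphism\<close>

context field
begin

text \<open>The length of a nonzero polynomial is its degree plus one, so the bound on
  \<open>length q\<close> provides more roots than the degree allows.\<close>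

lemma poly_zero_of_many_roots:
  assumes q: "q \<in> carrier (poly_ring R)" and A: "finite A" "A \<subseteq> carrier R"
    and root: "\<And>a. a \<in> A \<Longrightarrow> eval q a = \<zero>" and len: "length q \<le> card A"
  shows "q = []"
proof (rule ccontr)
  assume n: "q \<noteq> []"
  have "A \<subseteq> set_mset (roots q)"
    using roots_mem_iff_is_root[OF q] root A(2) n unfolding is_root_def by blast
  then have "mset_set A \<subseteq># mset_set (set_mset (roots q))"
    using A(1) by (simp add: subset_imp_msubset_mset_set)
  then have "mset_set A \<subseteq># roots q"
    using mset_set_set_mset_msubset subset_mset.order_trans by blast
  then have "card A \<le> size (roots q)" using size_mset_mono A(1) by fastforce
  also have "\<dots> \<le> degree q" using size_roots_le_degree[OF q] .
  finally show False using len n by (cases q) auto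
qed

lemma exists_poly_with_roots:
  assumes K: "subfield K R" and x: "\<And>i. i < n \<Longrightarrow> x i \<in> K"
  shows "\<exists>W\<in>carrier (K[X]). length W = Suc n \<and>
    (\<forall>z\<in>carrier R. eval W z = \<zero> \<longleftrightarrow> (\<exists>i<n. z = x i))"
  using x
proof (induction n)
  case 0
  have "[\<one>] \<in> carrier (K[X])"
    using subringE(3)[OF subfieldE(1)[OF K]] unfolding univ_poly_def polynomial_def by auto
  then show ?case by (intro bexI[of _ "[\<one>]"]) auto
next
  case (Suc n)
  note sr = subfieldE(1)[OF K]
  obtain W where W: "W \<in> carrier (K[X])" "length W = Suc n"
    "\<And>z. z \<in> carrier R \<Longrightarrow> eval W z = \<zero> \<longleftrightarrow> (\<exists>i<n. z = x i)"
    using Suc by (metis less_Suc_eq)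
  have xn: "x n \<in> K" "x n \<in> carrier R" using Suc.prems[of n] subfieldE(3)[OF K] by auto
  let ?l = "[\<one>, \<ominus> (x n)]"
  have l: "?l \<in> carrier (K[X])"
    using subringE(3,5)[OF sr] xn unfolding univ_poly_def polynomial_def by auto
  let ?W = "W \<otimes>\<^bsub>K[X]\<^esub> ?l"
  interpret UP: domain "K[X]" using univ_poly_is_domain[OF sr] .
  have c: "?W \<in> carrier (K[X])" using W(1) l by simp
  have Wn: "W \<noteq> []" using W(2) by auto
  have "?W \<noteq> []" using Wn UP.integral[OF _ W(1) l] by (auto simp: univ_poly_zero)
  moreover have "degree ?W = Suc n"
    using poly_mult_degree_eq[OF sr, of W ?l] W l Wn
    by (simp add: univ_poly_mult univ_poly_carrier)
  ultimately have "length ?W = Suc (Suc n)" by (cases ?W) auto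
  moreover have "eval ?W z = \<zero> \<longleftrightarrow> (\<exists>i<Suc n. z = x i)" if z: "z \<in> carrier R" for z
  proof -
    interpret ev: ring_hom_ring "K[X]" R "\<lambda>p. eval p z" using eval_ring_hom[OF sr z] .
    have e: "eval ?W z = eval W z \<otimes> eval ?l z" using ev.hom_mult[OF W(1) l] .
    have "eval ?l z = z \<ominus> x n" using z xn by (simp add: a_minus_def)
    then have "eval ?l z = \<zero> \<longleftrightarrow> z = x n" using z xn r_right_minus_eq by simp
    then show ?thesis
      unfolding e using integral_iff[OF ev.hom_closed[OF W(1)] ev.hom_closed[OF l]] W(3)[OF z]
      by (auto simp: less_Suc_eq)
  qed
  ultimately show ?case using c by blast
qed

text \<open>Newton's form: \<open>W\<close> vanishes exactly at the earlier nodes, so adding a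
  multiple of \<open>W\<close> corrects the value at the new node and leaves the others
  alone.\<close>

lemma poly_interpolation:
  assumes K: "subfield K R" and x: "\<And>i. i < n \<Longrightarrow> x i \<in> K" "inj_on x {..<n}"
    and y: "\<And>i. i < n \<Longrightarrow> y i \<in> K"
  shows "\<exists>q\<in>carrier (K[X]). length q \<le> n \<and> (\<forall>i<n. eval q (x i) = y i)"
  using x y
proof (induction n)
  case 0
  show ?case by (intro bexI[of _ "[]"]) (auto simp: univ_poly_zero_closed)
next
  case (Suc n)
  note sr = subfieldE(1)[OF K] and sc = subfieldE(3)[OF K]
  interpret UP: domain "K[X]" using univ_poly_is_domain[OF sr] .
  have inj: "inj_on x {..<n}" by (rule inj_on_subset[OF Suc.prems(2)]) auto
  have xK: "x i \<in> K" "y i \<in> K" if "i < Suc n" for i using Suc.prems(1,3) that by auto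
  have xc: "x i \<in> carrier R" if "i < Suc n" for i using Suc.prems(1)[OF that] sc by auto
  obtain q where q: "q \<in> carrier (K[X])" "length q \<le> n" "\<And>i. i < n \<Longrightarrow> eval q (x i) = y i"
    using Suc.IH[OF _ inj] xK by (meson less_SucI)
  obtain W where W: "W \<in> carrier (K[X])" "length W = Suc n"
    "\<And>z. z \<in> carrier R \<Longrightarrow> eval W z = \<zero> \<longleftrightarrow> (\<exists>i<n. z = x i)"
    using exists_poly_with_roots[OF K, of n x] xK by (meson less_SucI)
  have ev: "ring_hom_ring (K[X]) R (\<lambda>p. eval p (x i))" if "i < Suc n" for i
    using eval_ring_hom[OF sr xc[OF that]] .
  have evK: "eval p (x i) \<in> K" if "p \<in> carrier (K[X])" "i < Suc n" for p i
  proof -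
    have "eval p (x i) \<in> simple_extension K (x i)"
      unfolding simple_extension_as_eval_img[OF sc xc[OF that(2)]] using that(1) by (rule imageI)
    then show ?thesis
      using simple_extension_subring_incl[OF sr subset_refl xK(1)[OF that(2)]] by blast
  qed
  have "x n \<noteq> x i" if "i < n" for i
    using inj_onD[OF Suc.prems(2), of n i] that by auto
  then have Wn: "eval W (x n) \<in> K - {\<zero>}"
    using evK[OF W(1), of n] W(3)[OF xc[of n]] by auto
  define c where "c = (y n \<ominus> eval q (x n)) \<otimes> inv (eval W (x n))"
  have cK: "c \<in> K"
    unfolding c_def a_minus_def
    using subfield_m_inv(1)[OF K Wn] evK[OF q(1), of n] xK(2)[of n] subringE(5-7)[OF sr] by auto
  have cW: "c \<otimes> eval W (x n) = y n \<ominus> eval q (x n)"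
  proof -
    have "inv (eval W (x n)) \<otimes> eval W (x n) = \<one>" using subfield_m_inv(3)[OF K Wn] .
    moreover have "y n \<in> carrier R" "eval q (x n) \<in> carrier R" "eval W (x n) \<in> carrier R"
      "inv (eval W (x n)) \<in> carrier R"
      using xK(2)[of n] evK[OF q(1), of n] Wn subfield_m_inv(1)[OF K Wn] sc by auto
    ultimately show ?thesis unfolding c_def by (simp add: m_assoc)
  qed
  show ?case
  \<comment> \<open>The list \<open>[\<zero>]\<close> is not a valid polynomial, so a vanishing
    correction needs its own case.\<close>
  proof (cases "c = \<zero>")
    case True
    then have "y n \<ominus> eval q (x n) = \<zero>" using cW Wn sc by auto
    then have "eval q (x n) = y n"
      using xK(2)[of n] evK[OF q(1), of n] sc r_right_minus_eq by (metis lessI subsetD)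
    then show ?thesis using q by (metis le_SucI less_SucE)
  next
    case False
    have cp: "[c] \<in> carrier (K[X])" using cK False unfolding univ_poly_def polynomial_def by auto
    let ?q = "q \<oplus>\<^bsub>K[X]\<^esub> [c] \<otimes>\<^bsub>K[X]\<^esub> W"
    have m: "[c] \<otimes>\<^bsub>K[X]\<^esub> W = map (\<lambda>b. c \<otimes> b) W"
      using poly_mult_const(1)[OF sr, of W c] W(1) cK False
      by (simp add: univ_poly_mult univ_poly_carrier)
    have "length ?q \<le> Suc n"
      using poly_add_length_le[of q "[c] \<otimes>\<^bsub>K[X]\<^esub> W"] q(2) W(2)
      unfolding m univ_poly_add by simp
    moreover have "eval ?q (x i) = y i" if i: "i < Suc n" for i
    proof -
      interpret ev: ring_hom_ring "K[X]" R "\<lambda>p. eval p (x i)" using ev[OF i] .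
      have "eval ?q (x i) = eval q (x i) \<oplus> eval [c] (x i) \<otimes> eval W (x i)"
        using q(1) cp W(1) by simp
      also have "eval [c] (x i) = c" using cK sc xc[OF i] by auto
      finally have e: "eval ?q (x i) = eval q (x i) \<oplus> c \<otimes> eval W (x i)" .
      show ?thesis
      proof (cases "i = n")
        case True
        have "y n \<in> carrier R" "eval q (x n) \<in> carrier R"
          using xK(2)[of n] evK[OF q(1), of n] sc by auto
        then have "eval q (x n) \<oplus> (y n \<ominus> eval q (x n)) = y n" by algebra
        then show ?thesis using e cW True by simp
      next
        case False
        then have "i < n" using i by simp
        moreover from this have "eval W (x i) = \<zero>" using W(3)[OF xc[OF i]] by blast
        ultimately show ?thesis
          using e q(3) xK(2)[OF i] cK sc by (simp add: subset_iff)
      qed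
    qed
    ultimately show ?thesis using q(1) cp W(1) by blast
  qed
qed

end

section \<open>Endomorphisms of a subfield and their fixed elements\<close>

definition fixed_elements :: "'a set \<Rightarrow> ('a \<Rightarrow> 'a) \<Rightarrow> 'a set" where
  "fixed_elements T h = {x \<in> T. h x = x}"

text \<open>An endomorphism is enough: it is injective because \<open>T\<close> is a field, and the
  arguments about fixed fields and interpolation rely on nothing more. This spares the construction
  of an inverse when \<open>h\<close> is obtained by Zorn's lemma.\<close>

locale subfield_endo = field R for R (structure) +
  fixes T :: "'a set" and h :: "'a \<Rightarrow> 'a"
  assumes T: "subfield T R"
    and h_closed: "x \<in> T \<Longrightarrow> h x \<in> T"
    and h_add: "\<lbrakk> x \<in> T; y \<in> T \<rbrakk> \<Longrightarrow> h (x \<oplus> y) = h x \<oplus> h y"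
    and h_mult: "\<lbrakk> x \<in> T; y \<in> T \<rbrakk> \<Longrightarrow> h (x \<otimes> y) = h x \<otimes> h y"
    and h_one: "h \<one> = \<one>"
begin

lemmas T_ring = subfieldE(1)[OF T] and T_carrier = subfieldE(3)[OF T]

lemma T_mem: "x \<in> T \<Longrightarrow> x \<in> carrier R" using T_carrier by blast

lemma iterate: "subfield_endo R T (h ^^ m)"
proof (induction m)
  case 0
  show ?case by (intro subfield_endo.intro subfield_endo_axioms.intro field_axioms T) auto
next
  case (Suc m)
  then interpret m: subfield_endo R T "h ^^ m" .
  show ?case
    by (intro subfield_endo.intro subfield_endo_axioms.intro field_axioms T)
      (auto simp: h_closed h_add h_mult h_one m.h_closed m.h_add m.h_mult m.h_one)
qed

lemma h_zero: "h \<zero> = \<zero>"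
proof -
  have z: "\<zero> \<in> T" using subringE(2)[OF T_ring] .
  then have "h \<zero> \<oplus> h \<zero> = h \<zero> \<oplus> \<zero>" using h_add[OF z z] T_mem[OF h_closed[OF z]] by simp
  then show ?thesis using T_mem[OF h_closed[OF z]] by (metis add.l_cancel zero_closed)
qed

lemma h_minus: "x \<in> T \<Longrightarrow> h (\<ominus> x) = \<ominus> h x"
proof -
  assume x: "x \<in> T"
  then have m: "\<ominus> x \<in> T" using subringE(5)[OF T_ring] by simp
  have "h (\<ominus> x) \<oplus> h x = \<zero>" using h_add[OF m x] h_zero x T_mem by (simp add: l_neg)
  then show ?thesis using T_mem h_closed x m by (metis minus_equality)
qed

lemma h_nonzero: "\<lbrakk> x \<in> T; x \<noteq> \<zero> \<rbrakk> \<Longrightarrow> h x \<noteq> \<zero>"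
proof
  assume x: "x \<in> T" "x \<noteq> \<zero>" and z: "h x = \<zero>"
  have i: "inv x \<in> T" "x \<otimes> inv x = \<one>" using subfield_m_inv[OF T, of x] x by auto
  then have "\<one> = h x \<otimes> h (inv x)" using h_mult[OF x(1) i(1)] h_one by simp
  then show False using z T_mem[OF h_closed[OF i(1)]] by simp
qed

lemma h_inj: "inj_on h T"
proof (rule inj_onI)
  fix x y assume xy: "x \<in> T" "y \<in> T" "h x = h y"
  have m: "\<ominus> y \<in> T" using subringE(5)[OF T_ring] xy(2) by simp
  have "h (x \<ominus> y) = \<zero>"
    unfolding a_minus_def using h_add[OF xy(1) m] h_minus[OF xy(2)] xy T_mem h_closed
    by (simp add: r_neg)
  moreover have "x \<ominus> y \<in> T" unfolding a_minus_def using subringE(7)[OF T_ring xy(1) m] .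
  ultimately have "x \<ominus> y = \<zero>" using h_nonzero by blast
  then show "x = y" using xy T_mem r_right_minus_eq by blast
qed

lemma iterate_inj: "inj_on (h ^^ m) T"
  using subfield_endo.h_inj[OF iterate] .

lemma iterate_closed: "x \<in> T \<Longrightarrow> (h ^^ m) x \<in> T"
  using subfield_endo.h_closed[OF iterate] .

lemma h_pow: "x \<in> T \<Longrightarrow> h (x [^] (n::nat)) = h x [^] n \<and> x [^] n \<in> T"
proof (induction n)
  case 0
  then show ?case using h_one subringE(3)[OF T_ring] by simp
next
  case (Suc n)
  then show ?case using h_mult subringE(6)[OF T_ring] by simp
qed

lemma h_eval: "\<lbrakk> set q \<subseteq> T; x \<in> T \<rbrakk> \<Longrightarrow> h (eval q x) = eval (map h q) (h x) \<and> eval q x \<in> T"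
proof (induction q)
  case Nil
  then show ?case using h_zero subringE(2)[OF T_ring] by simp
next
  case (Cons a q)
  then show ?case using h_pow[of x "length q"] h_add h_mult subringE(6,7)[OF T_ring] by simp
qed

lemma fixed_elements_subfield: "subfield (fixed_elements T h) R"
proof (rule subfieldI'[OF subringI])
  show "fixed_elements T h \<subseteq> carrier R" using T_carrier unfolding fixed_elements_def by auto
  show "\<one> \<in> fixed_elements T h" using subringE(3)[OF T_ring] h_one unfolding fixed_elements_def by simp
  fix x assume x: "x \<in> fixed_elements T h"
  then show "\<ominus> x \<in> fixed_elements T h"
    using subringE(5)[OF T_ring] h_minus unfolding fixed_elements_def by simp
  fix y assume "y \<in> fixed_elements T h"
  then show "x \<otimes> y \<in> fixed_elements T h" "x \<oplus> y \<in> fixed_elements T h"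
    using x subringE(6,7)[OF T_ring] h_add h_mult unfolding fixed_elements_def by auto
next
  fix x assume x: "x \<in> fixed_elements T h - {\<zero>}"
  then have xT: "x \<in> T - {\<zero>}" and hx: "h x = x" unfolding fixed_elements_def by auto
  note i = subfield_m_inv[OF T xT]
  have iT: "inv x \<in> T" using i(1) by simp
  have "h (inv x) \<otimes> x = \<one>" using h_mult[OF iT, of x] xT hx i(3) h_one by simp
  then have "h (inv x) = inv x"
    using xT iT T_mem h_closed by (metis DiffD1 comm_inv_char m_comm)
  then show "inv x \<in> fixed_elements T h" using iT unfolding fixed_elements_def by simp
qed

lemma fixed_elements_incl: "fixed_elements T h \<subseteq> T"
  unfolding fixed_elements_def by blast

lemma fixed_elements_iterate_mono: "fixed_elements T (h ^^ m) \<subseteq> fixed_elements T (h ^^ (m * k))"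
proof (induction k)
  case (Suc k)
  have "(h ^^ (m * Suc k)) x = (h ^^ m) ((h ^^ (m * k)) x)" for x
    by (simp add: funpow_add)
  with Suc show ?case unfolding fixed_elements_def by auto
qed (auto simp: fixed_elements_def)

text \<open>Vandermonde: a relation with coefficients fixed by \<open>h\<close> is a polynomial that vanishes at all
  the elements \<open>(h ^^ i) x\<close>.\<close>

lemma independent_powers:
  assumes x: "x \<in> T" and inj: "inj_on (\<lambda>i. (h ^^ i) x) {..<n}"
  shows "independent (fixed_elements T h) (exp_base x n)"
proof (rule ccontr)
  assume dep: "dependent (fixed_elements T h) (exp_base x n)"
  have len: "length (exp_base x n) = n" unfolding exp_base_def by simp
  obtain Ks where Ks: "length Ks = n" "combine Ks (exp_base x n) = \<zero>"
    "set Ks \<subseteq> fixed_elements T h" "set Ks \<noteq> {\<zero>}"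
    using dependent_imp_non_trivial_combine[OF fixed_elements_subfield exp_base_closed[OF T_mem[OF x]] dep]
    unfolding len by blast
  have n: "n \<noteq> 0" using dep li_Nil unfolding exp_base_def by (metis list.simps(8) rev.simps(1) upt_0)
  have KT: "set Ks \<subseteq> T" "set Ks \<subseteq> carrier R" using Ks(3) fixed_elements_incl T_carrier by blast+
  have e: "eval Ks x = \<zero>" using Ks(1,2) combine_eq_eval[of Ks x] by simp
  have roots: "eval Ks ((h ^^ i) x) = \<zero>" for i
  proof (induction i)
    case (Suc i)
    have "map h Ks = Ks" using Ks(3) unfolding fixed_elements_def by (auto intro: map_idI)
    then show ?case using h_eval[OF KT(1) iterate_closed[OF x, of i]] Suc h_zero by simp
  qed (use e in simp)
  let ?A = "(\<lambda>i. (h ^^ i) x) ` {..<n}"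
  \<comment> \<open>\<open>Ks\<close> may begin with zeros; normalizing turns it into a polynomial
    with the same values and length at most \<open>n\<close>, too short for \<open>n\<close>
    distinct roots.\<close>
  have "normalize Ks = []"
  proof (rule poly_zero_of_many_roots[where A = ?A])
    show "normalize Ks \<in> carrier (poly_ring R)"
      using normalize_gives_polynomial[OF KT(2)] by (simp add: univ_poly_carrier)
    show "finite ?A" by simp
    show "?A \<subseteq> carrier R" using iterate_closed[OF x] T_mem by blast
    show "eval (normalize Ks) a = \<zero>" if "a \<in> ?A" for a
      using that roots eval_normalize[OF KT(2)] iterate_closed[OF x] T_mem by auto
    show "length (normalize Ks) \<le> card ?A"
      using normalize_length_le[of Ks] Ks(1) inj by (simp add: card_image)
  qed
  then have "Ks = replicate (length Ks) \<zero>" using normalize_trick[of Ks] by simp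
  then have "set Ks = {\<zero>}" using Ks(1) n by (metis set_replicate)
  then show False using Ks(4) by simp
qed

text \<open>If \<open>a\<close> is fixed by \<open>h ^^ n\<close>, then \<open>h\<close> permutes the interpolation conditions
  \<open>(h ^^ i) x \<mapsto> (h ^^ i) a\<close>; by uniqueness it fixes the interpolating polynomial.\<close>

lemma fixed_elements_iterate_eq_Span:
  assumes x: "x \<in> T" and inj: "inj_on (\<lambda>i. (h ^^ i) x) {..<n}" and n: "n > 0"
    and per: "(h ^^ n) x = x"
  shows "fixed_elements T (h ^^ n) = Span (fixed_elements T h) (exp_base x n)"
proof
  let ?K = "fixed_elements T h"
  note K = fixed_elements_subfield
  have xc: "x \<in> carrier R" using x T_mem by blast
  interpret n: subfield_endo R T "h ^^ n" using iterate .
  show "Span ?K (exp_base x n) \<subseteq> fixed_elements T (h ^^ n)"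
  proof (rule Span_subset_subring[OF K subfieldE(1)[OF n.fixed_elements_subfield]])
    show "?K \<subseteq> fixed_elements T (h ^^ n)" using fixed_elements_iterate_mono[of 1 n] by simp
    have "x [^] (i::nat) \<in> fixed_elements T (h ^^ n)" for i
      using n.h_pow[OF x, of i] per unfolding fixed_elements_def by simp
    then show "set (exp_base x n) \<subseteq> fixed_elements T (h ^^ n)" unfolding exp_base_def by auto
  qed
  show "fixed_elements T (h ^^ n) \<subseteq> Span ?K (exp_base x n)"
  proof
    fix a assume "a \<in> fixed_elements T (h ^^ n)"
    then have a: "a \<in> T" "(h ^^ n) a = a" unfolding fixed_elements_def by auto
    have ex: "\<exists>q\<in>carrier (T[X]). length q \<le> n \<and> (\<forall>i<n. eval q ((h ^^ i) x) = (h ^^ i) a)"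
      by (rule poly_interpolation[OF T _ inj]) (simp_all add: iterate_closed x a(1))
    obtain q where q: "q \<in> carrier (T[X])" "length q \<le> n"
      "\<And>i. i < n \<Longrightarrow> eval q ((h ^^ i) x) = (h ^^ i) a"
      using ex by blast
    have qT: "set q \<subseteq> T" using q(1) polynomial_incl by (simp add: univ_poly_carrier[symmetric])
    \<comment> \<open>A polynomial needs a nonzero head coefficient, and \<open>h\<close> preserves
      this by \<open>h_nonzero\<close>.\<close>
    have q': "map h q \<in> carrier (T[X])"
    proof (cases q)
      case Nil
      then show ?thesis using univ_poly_zero_closed by simp
    next
      case (Cons b r)
      then have "h b \<noteq> \<zero>"
        using q(1) h_nonzero[of b] unfolding univ_poly_def polynomial_def by auto
      then show ?thesis
        using Cons qT h_closed unfolding univ_poly_def polynomial_def by auto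
    qed
    have ev': "eval (map h q) ((h ^^ i) x) = (h ^^ i) a" if i: "i < n" for i
    proof -
      \<comment> \<open>\<open>j\<close> is the cyclic predecessor of \<open>i\<close>. For
        \<open>i = 0\<close> it is n - 1, which is correct because \<open>h ^^ n\<close> fixes both
        \<open>x\<close> and \<open>a\<close>.\<close>
      define j where "j = (if i = 0 then n - 1 else i - 1)"
      have j: "j < n" "(h ^^ i) x = h ((h ^^ j) x)" "(h ^^ i) a = h ((h ^^ j) a)"
      proof -
        have "h ((h ^^ (n - 1)) y) = (h ^^ n) y" for y using n by (cases n) auto
        moreover have "i \<noteq> 0 \<Longrightarrow> h ((h ^^ (i - 1)) y) = (h ^^ i) y" for y by (cases i) auto
        ultimately show "j < n" "(h ^^ i) x = h ((h ^^ j) x)" "(h ^^ i) a = h ((h ^^ j) a)"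
          using per a(2) i unfolding j_def by auto
      qed
      then show ?thesis using h_eval[OF qT iterate_closed[OF x, of j]] q(3)[OF j(1)] by simp
    qed
    interpret UP: domain "T[X]" using univ_poly_is_domain[OF T_ring] .
    have "q \<ominus>\<^bsub>T[X]\<^esub> map h q = []"
    proof (rule poly_zero_of_many_roots[where A = "(\<lambda>i. (h ^^ i) x) ` {..<n}"])
      have c: "q \<ominus>\<^bsub>T[X]\<^esub> map h q \<in> carrier (T[X])" using q(1) q' by simp
      then show "q \<ominus>\<^bsub>T[X]\<^esub> map h q \<in> carrier (poly_ring R)"
        using carrier_polynomial_shell[OF T_ring] by blast
      show "(\<lambda>i. (h ^^ i) x) ` {..<n} \<subseteq> carrier R" using iterate_closed[OF x] T_mem by blast
      show "eval (q \<ominus>\<^bsub>T[X]\<^esub> map h q) b = \<zero>" if b: "b \<in> (\<lambda>i. (h ^^ i) x) ` {..<n}" for b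
      proof -
        obtain i where i: "i < n" "b = (h ^^ i) x" using b by blast
        have bc: "b \<in> carrier R" using i iterate_closed[OF x] T_mem by blast
        interpret ev: ring_hom_ring "T[X]" R "\<lambda>p. eval p b" using eval_ring_hom[OF T_ring bc] .
        have "eval (q \<ominus>\<^bsub>T[X]\<^esub> map h q) b = eval q b \<ominus> eval (map h q) b"
          unfolding a_minus_def using q(1) q' by simp
        also have "\<dots> = (h ^^ i) a \<ominus> (h ^^ i) a" using i q(3) ev' by simp
        also have "\<dots> = \<zero>" using iterate_closed[OF a(1)] T_mem by (simp add: a_minus_def r_neg)
        finally show ?thesis .
      qed
      have "length (q \<ominus>\<^bsub>T[X]\<^esub> map h q) \<le> max (length q) (length (map h q))"
        unfolding a_minus_def univ_poly_add
        using poly_add_length_le[of q "\<ominus>\<^bsub>T[X]\<^esub> map h q"] univ_poly_a_inv_length[OF T_ring q'] by simp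
      then show "length (q \<ominus>\<^bsub>T[X]\<^esub> map h q) \<le> card ((\<lambda>i. (h ^^ i) x) ` {..<n})"
        using q(2) inj by (simp add: card_image)
    qed simp
    then have "q = map h q"
      using UP.r_right_minus_eq[OF q(1) q'] by (simp add: univ_poly_zero)
    then have "\<forall>b\<in>set q. h b = b" by (metis map_eq_conv map_ident list.map_ident)
    then have "q \<in> carrier (?K[X])"
      using q(1) qT unfolding univ_poly_def polynomial_def fixed_elements_def by auto
    moreover have "a = eval q x" using q(3)[of 0] n by simp
    ultimately show "a \<in> Span ?K (exp_base x n)"
      unfolding Span_eq_eval_img[OF K xc] using q(2) by blast
  qed
qed

end

subsection \<open>Extending embeddings by square roots\<close>

context field
begin

text \<open>Partial embeddings are kept as relations so that inclusion orders them and a chain has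
  its union as upper bound. The clause on \<open>\<zero>\<close> forces single-valuedness: two
  images of the same element, each added to an image of its negative, would both give an image of
  \<open>\<zero>\<close>.\<close>

definition embedding_graph :: "('a \<times> 'a) set \<Rightarrow> bool" where
  "embedding_graph G \<longleftrightarrow> G \<subseteq> carrier R \<times> carrier R \<and> subfield (Domain G) R \<and> (\<one>, \<one>) \<in> G \<and>
    (\<forall>x y u v. (x, y) \<in> G \<longrightarrow> (u, v) \<in> G \<longrightarrow> (x \<oplus> u, y \<oplus> v) \<in> G \<and> (x \<otimes> u, y \<otimes> v) \<in> G) \<and>
    (\<forall>y. (\<zero>, y) \<in> G \<longrightarrow> y = \<zero>)"

lemma embedding_graphD:
  assumes "embedding_graph G"
  shows "G \<subseteq> carrier R \<times> carrier R" "subfield (Domain G) R" "(\<one>, \<one>) \<in> G"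
    "\<And>x y u v. \<lbrakk> (x, y) \<in> G; (u, v) \<in> G \<rbrakk> \<Longrightarrow> (x \<oplus> u, y \<oplus> v) \<in> G"
    "\<And>x y u v. \<lbrakk> (x, y) \<in> G; (u, v) \<in> G \<rbrakk> \<Longrightarrow> (x \<otimes> u, y \<otimes> v) \<in> G"
    "\<And>y. (\<zero>, y) \<in> G \<Longrightarrow> y = \<zero>"
  using assms unfolding embedding_graph_def by blast+

lemma embedding_graph_zero:
  assumes "embedding_graph G"
  shows "(\<zero>, \<zero>) \<in> G"
proof -
  note D = embedding_graphD[OF assms]
  have "\<zero> \<in> Domain G" using subringE(2)[OF subfieldE(1)[OF D(2)]] .
  then show ?thesis using D(6) by blast
qed

lemma embedding_graph_unique:
  assumes "embedding_graph G" "(x, y) \<in> G" "(x, z) \<in> G"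
  shows "y = z"
proof -
  note D = embedding_graphD[OF assms(1)]
  have "\<ominus> x \<in> Domain G" using assms(2) subringE(5)[OF subfieldE(1)[OF D(2)]] by blast
  then obtain w where w: "(\<ominus> x, w) \<in> G" by blast
  have c: "x \<in> carrier R" "y \<in> carrier R" "z \<in> carrier R" "w \<in> carrier R"
    using D(1) assms(2,3) w by auto
  have "(\<zero>, w \<oplus> y) \<in> G" "(\<zero>, w \<oplus> z) \<in> G"
    using D(4)[OF w assms(2)] D(4)[OF w assms(3)] c by (auto simp: l_neg)
  then have "w \<oplus> y = w \<oplus> z" using D(6) by metis
  then show ?thesis using c by (metis add.l_cancel)
qed

text \<open>As \<open>c\<close> lies outside the domain, a + bc = 0 forces a = b = 0, so sending
  \<open>c\<close> to \<open>c'\<close> is consistent; products are respected because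
  \<open>c'\<close> squares to the image of c^2.\<close>

lemma embedding_graph_extend:
  assumes G: "embedding_graph G" and c: "c \<in> carrier R" "c' \<in> carrier R" "c \<notin> Domain G"
    and sq: "(c \<otimes> c, c' \<otimes> c') \<in> G"
  defines "G' \<equiv> {(a \<oplus> b \<otimes> c, a' \<oplus> b' \<otimes> c') | a a' b b'. (a, a') \<in> G \<and> (b, b') \<in> G}"
  shows "embedding_graph G'" and "G \<subseteq> G'" and "(c, c') \<in> G'"
proof -
  note D = embedding_graphD[OF G] and z = embedding_graph_zero[OF G]
  have mem: "x \<in> carrier R" "y \<in> carrier R" if "(x, y) \<in> G" for x y using D(1) that by auto
  have memG': "(x, y) \<in> G' \<longleftrightarrow> (\<exists>a a' b b'. (a, a') \<in> G \<and> (b, b') \<in> G \<and>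
      x = a \<oplus> b \<otimes> c \<and> y = a' \<oplus> b' \<otimes> c')" for x y
    unfolding G'_def by auto
  show "G \<subseteq> G'"
  proof clarify
    fix x y assume xy: "(x, y) \<in> G"
    then have "x = x \<oplus> \<zero> \<otimes> c" "y = y \<oplus> \<zero> \<otimes> c'" using mem[OF xy] c by simp_all
    then show "(x, y) \<in> G'" unfolding memG' using xy z by blast
  qed
  have "c = \<zero> \<oplus> \<one> \<otimes> c" "c' = \<zero> \<oplus> \<one> \<otimes> c'" using c by simp_all
  then show "(c, c') \<in> G'" unfolding memG' using z D(3) by blast
  have dom: "Domain G' = simple_extension (Domain G) c"
  proof -
    have "Domain G' = {a \<oplus> b \<otimes> c | a b. a \<in> Domain G \<and> b \<in> Domain G}"
      unfolding G'_def by blast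
    then show ?thesis
      using simple_extension_square_root[OF subfieldE(1)[OF D(2)] c(1)] sq by blast
  qed
  show "embedding_graph G'"
    unfolding embedding_graph_def
  proof (intro conjI allI impI)
    show "G' \<subseteq> carrier R \<times> carrier R"
      unfolding G'_def using mem c by auto
    show "subfield (Domain G') R"
      unfolding dom using simple_extension_square_root_subfield[OF D(2) c(1)] sq by blast
    show "(\<one>, \<one>) \<in> G'" using D(3) \<open>G \<subseteq> G'\<close> by blast
  next
    fix x y u v assume "(x, y) \<in> G'" "(u, v) \<in> G'"
    then obtain a a' b b' e e' f f' where
      ab: "(a, a') \<in> G" "(b, b') \<in> G" "x = a \<oplus> b \<otimes> c" "y = a' \<oplus> b' \<otimes> c'" and
      ef: "(e, e') \<in> G" "(f, f') \<in> G" "u = e \<oplus> f \<otimes> c" "v = e' \<oplus> f' \<otimes> c'"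
      unfolding memG' by blast
    note m = mem[OF ab(1)] mem[OF ab(2)] mem[OF ef(1)] mem[OF ef(2)] c(1,2)
    have "x \<oplus> u = (a \<oplus> e) \<oplus> (b \<oplus> f) \<otimes> c" "y \<oplus> v = (a' \<oplus> e') \<oplus> (b' \<oplus> f') \<otimes> c'"
      unfolding ab ef using m by algebra+
    then show "(x \<oplus> u, y \<oplus> v) \<in> G'"
      unfolding memG' using D(4)[OF ab(1) ef(1)] D(4)[OF ab(2) ef(2)] by blast
    have "x \<otimes> u = (a \<otimes> e \<oplus> b \<otimes> f \<otimes> (c \<otimes> c)) \<oplus> (a \<otimes> f \<oplus> b \<otimes> e) \<otimes> c"
      "y \<otimes> v = (a' \<otimes> e' \<oplus> b' \<otimes> f' \<otimes> (c' \<otimes> c')) \<oplus> (a' \<otimes> f' \<oplus> b' \<otimes> e') \<otimes> c'"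
      unfolding ab ef using m by algebra+
    then show "(x \<otimes> u, y \<otimes> v) \<in> G'"
      unfolding memG'
      using D(4)[OF D(5)[OF ab(1) ef(1)] D(5)[OF D(5)[OF ab(2) ef(2)] sq]]
        D(4)[OF D(5)[OF ab(1) ef(2)] D(5)[OF ab(2) ef(1)]] by blast
  next
    fix y assume "(\<zero>, y) \<in> G'"
    then obtain a a' b b' where
      ab: "(a, a') \<in> G" "(b, b') \<in> G" "\<zero> = a \<oplus> b \<otimes> c" "y = a' \<oplus> b' \<otimes> c'"
      unfolding memG' by blast
    note m = mem[OF ab(1)] mem[OF ab(2)]
    have b: "b = \<zero>"
    proof (rule ccontr)
      assume "b \<noteq> \<zero>"
      have "b \<otimes> c = \<ominus> a" using ab(3) m c by (metis a_comm m_closed minus_equality)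
      also have "\<dots> \<in> Domain G" using ab(1) subringE(5)[OF subfieldE(1)[OF D(2)]] by blast
      finally have "c \<in> Domain G"
        using subfield_m_inv_simprule[OF D(2) _ c(1), of b] ab(2) \<open>b \<noteq> \<zero>\<close> by blast
      then show False using c(3) by simp
    qed
    then have "a \<oplus> b \<otimes> c = a" using m c by simp
    then have "a = \<zero>" using ab(3) by metis
    then have "a' = \<zero>" "b' = \<zero>" using b ab(1,2) D(6) by blast+
    then show "y = \<zero>" using ab(4) c by simp
  qed
qed

lemma embedding_graph_Union:
  assumes "C \<noteq> {}" and graph: "\<And>G. G \<in> C \<Longrightarrow> embedding_graph G"
    and chain: "\<And>G H. \<lbrakk> G \<in> C; H \<in> C \<rbrakk> \<Longrightarrow> G \<subseteq> H \<or> H \<subseteq> G"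
  shows "embedding_graph (\<Union>C)"
proof -
  note D = embedding_graphD[OF graph]
  have two: "\<exists>G\<in>C. p \<in> G \<and> q \<in> G" if "p \<in> \<Union>C" "q \<in> \<Union>C" for p q
    using that chain by blast
  have add: "(x \<oplus> u, y \<oplus> v) \<in> \<Union>C" "(x \<otimes> u, y \<otimes> v) \<in> \<Union>C"
    if xy: "(x, y) \<in> \<Union>C" "(u, v) \<in> \<Union>C" for x y u v
  proof -
    obtain G where "G \<in> C" "(x, y) \<in> G" "(u, v) \<in> G" using two[OF xy] by blast
    then show "(x \<oplus> u, y \<oplus> v) \<in> \<Union>C" "(x \<otimes> u, y \<otimes> v) \<in> \<Union>C"
      using D(4,5) by (meson UnionI)+
  qed
  have one: "(\<one>, \<one>) \<in> \<Union>C" using assms(1) D(3) by blast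
  have carr: "\<Union>C \<subseteq> carrier R \<times> carrier R" using D(1) by (meson Sup_least)
  have dom: "\<exists>G\<in>C. x \<in> Domain G" if "x \<in> Domain (\<Union>C)" for x using that by blast
  have dom': "x \<in> Domain (\<Union>C)" if "G \<in> C" "x \<in> Domain G" for x G using that by blast
  have "subfield (Domain (\<Union>C)) R"
  proof (rule subfieldI'[OF subringI])
    show "Domain (\<Union>C) \<subseteq> carrier R" using carr by blast
    show "\<one> \<in> Domain (\<Union>C)" using one by blast
    show "\<ominus> x \<in> Domain (\<Union>C)" if x: "x \<in> Domain (\<Union>C)" for x
    proof -
      obtain G where "G \<in> C" "x \<in> Domain G" using dom[OF x] by blast
      then show ?thesis using dom' subringE(5)[OF subfieldE(1)[OF D(2)]] by metis
    qed
    show "inv x \<in> Domain (\<Union>C)" if x: "x \<in> Domain (\<Union>C) - {\<zero>}" for x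
    proof -
      obtain G where "G \<in> C" "x \<in> Domain G - {\<zero>}" using dom x by blast
      then show ?thesis using dom' subfield_m_inv(1)[OF D(2)] by (metis DiffD1)
    qed
    show "x \<otimes> y \<in> Domain (\<Union>C)" "x \<oplus> y \<in> Domain (\<Union>C)"
      if xy: "x \<in> Domain (\<Union>C)" "y \<in> Domain (\<Union>C)" for x y
      using xy add by (meson Domain.simps)+
  qed
  then show ?thesis
    unfolding embedding_graph_def using carr one add D(6) by (intro conjI allI impI) blast+
qed

lemma embedding_graph_endo:
  assumes G: "embedding_graph G" and T: "Domain G = T" "G \<subseteq> T \<times> T"
  obtains h where "subfield_endo R T h" "\<And>x y. (x, y) \<in> G \<Longrightarrow> h x = y"
proof -
  note D = embedding_graphD[OF G]
  define h where "h x = (THE y. (x, y) \<in> G)" for x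
  have h: "h x = y" if "(x, y) \<in> G" for x y
    unfolding h_def using that embedding_graph_unique[OF G] by (rule the_equality) (use that in auto)
  have hG: "(x, h x) \<in> G" if "x \<in> T" for x using that T(1) h by blast
  have "subfield_endo R T h"
  proof (intro subfield_endo.intro subfield_endo_axioms.intro field_axioms)
    show "subfield T R" using D(2) T(1) by simp
    show "h x \<in> T" if "x \<in> T" for x using hG[OF that] T(2) by blast
    show "h \<one> = \<one>" using h[OF D(3)] .
    show "h (x \<oplus> y) = h x \<oplus> h y" "h (x \<otimes> y) = h x \<otimes> h y" if "x \<in> T" "y \<in> T" for x y
      using h[OF D(4)[OF hG[OF that(1)] hG[OF that(2)]]] h[OF D(5)[OF hG[OF that(1)] hG[OF that(2)]]] .
  qed
  then show ?thesis using that h by blast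
qed

text \<open>Pairing the values of one polynomial at \<open>x\<close> and at \<open>y\<close> avoids
  choosing representatives. If \<open>q\<close> vanishes at \<open>x\<close>, the minimal polynomial
  of \<open>x\<close> divides it, so it vanishes at the conjugate \<open>y\<close> too.\<close>

lemma embedding_graph_simple_extension:
  assumes K: "subfield K R" and x: "x \<in> carrier R" "(algebraic over K) x"
    and y: "y \<in> carrier R" "eval (Irr K x) y = \<zero>"
  defines "G \<equiv> {(eval q x, eval q y) | q. q \<in> carrier (K[X])}"
  shows "embedding_graph G" and "Domain G = simple_extension K x"
    and "(x, y) \<in> G" and "\<And>k. k \<in> K \<Longrightarrow> (k, k) \<in> G"
    and "G \<subseteq> simple_extension K x \<times> simple_extension K y"
proof -
  note sr = subfieldE(1)[OF K] and sc = subfieldE(3)[OF K]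
  interpret UP: domain "K[X]" using univ_poly_is_domain[OF sr] .
  interpret ex: ring_hom_ring "K[X]" R "\<lambda>q. eval q x" using eval_ring_hom[OF sr x(1)] .
  interpret ey: ring_hom_ring "K[X]" R "\<lambda>q. eval q y" using eval_ring_hom[OF sr y(1)] .
  note simg = simple_extension_as_eval_img[OF sc]
  have memG: "(u, v) \<in> G \<longleftrightarrow> (\<exists>q\<in>carrier (K[X]). u = eval q x \<and> v = eval q y)" for u v
    unfolding G_def by auto
  show dom: "Domain G = simple_extension K x" unfolding simg[OF x(1)] G_def by auto
  show "G \<subseteq> simple_extension K x \<times> simple_extension K y"
    unfolding simg[OF x(1)] simg[OF y(1)] G_def by auto
  show "(x, y) \<in> G"
    unfolding memG by (rule bexI[OF _ var_closed(1)[OF sr]]) (simp add: eval_var x(1) y(1))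
  show KG: "(k, k) \<in> G" if k: "k \<in> K" for k
  proof -
    have "[k] \<in> carrier (K[X]) \<or> k = \<zero>" using k unfolding univ_poly_def polynomial_def by auto
    moreover have "eval [k] x = k" "eval [k] y = k" using k sc by auto
    moreover have "eval [] x = \<zero>" "eval [] y = \<zero>" "[] \<in> carrier (K[X])"
      using univ_poly_zero_closed by auto
    ultimately show ?thesis unfolding memG by metis
  qed
  show "embedding_graph G"
    unfolding embedding_graph_def
  proof (intro conjI allI impI)
    show "G \<subseteq> carrier R \<times> carrier R" unfolding G_def using ex.hom_closed ey.hom_closed by auto
    show "subfield (Domain G) R"
      unfolding dom using simple_extension_is_subfield[OF K x(1)] x(2) by simp
    show "(\<one>, \<one>) \<in> G" using KG subringE(3)[OF sr] by blast
  next
    fix a b u v assume "(a, b) \<in> G" "(u, v) \<in> G"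
    then obtain q r where q: "q \<in> carrier (K[X])" "a = eval q x" "b = eval q y"
      and r: "r \<in> carrier (K[X])" "u = eval r x" "v = eval r y" unfolding memG by blast
    have "a \<oplus> u = eval (q \<oplus>\<^bsub>K[X]\<^esub> r) x" "b \<oplus> v = eval (q \<oplus>\<^bsub>K[X]\<^esub> r) y" using q r by simp_all
    then show "(a \<oplus> u, b \<oplus> v) \<in> G" unfolding memG using q(1) r(1) by blast
    have "a \<otimes> u = eval (q \<otimes>\<^bsub>K[X]\<^esub> r) x" "b \<otimes> v = eval (q \<otimes>\<^bsub>K[X]\<^esub> r) y" using q r by simp_all
    then show "(a \<otimes> u, b \<otimes> v) \<in> G" unfolding memG using q(1) r(1) by blast
  next
    fix v assume "(\<zero>, v) \<in> G"
    then obtain q where q: "q \<in> carrier (K[X])" "eval q x = \<zero>" "v = eval q y"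
      unfolding memG by metis
    have "Irr K x pdivides q" using Irr_minimal[OF K x q(1,2)] .
    then show "v = \<zero>"
      using pdivides_imp_root_sharing[OF carrier_polynomial_shell[OF sr IrrE(1)[OF K x]] _ y]
        q(3) by simp
  qed
qed

end

context algebraically_closed
begin

text \<open>Take a maximal graph inside \<open>T \<times> T\<close>. A root of a sum of two squares
  from its domain can be sent to a root of the sum of the image squares, and the latter again lies
  in \<open>T\<close>. So by maximality the domain is closed under such roots, and minimality of the
  pythagorean closure makes it all of \<open>T\<close>.\<close>

lemma embedding_graph_pyth_closure_endo:
  assumes F: "subfield F L" and T: "T = pyth_closure L F"
    and G: "embedding_graph G" "F \<subseteq> Domain G" "G \<subseteq> T \<times> T"
  obtains h where "subfield_endo L T h" "\<And>x y. (x, y) \<in> G \<Longrightarrow> h x = y"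
proof -
  let ?A = "{H. embedding_graph H \<and> G \<subseteq> H \<and> H \<subseteq> T \<times> T}"
  have "\<exists>M\<in>?A. \<forall>H\<in>?A. M \<subseteq> H \<longrightarrow> H = M"
  proof (rule subset_Zorn_nonempty)
    show "?A \<noteq> {}" using G by blast
    fix C assume C: "C \<noteq> {}" "subset.chain ?A C"
    have CA: "H \<in> ?A" if "H \<in> C" for H using C(2) that unfolding subset_chain_def by blast
    have chain: "G \<subseteq> H \<or> H \<subseteq> G" if "G \<in> C" "H \<in> C" for G H
      using C(2) that unfolding subset_chain_def by blast
    have "embedding_graph (\<Union>C)"
      by (rule embedding_graph_Union[OF C(1) _ chain]) (use CA in auto)
    moreover have "G \<subseteq> \<Union>C"
    proof -
      obtain H where "H \<in> C" using C(1) by blast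
      then show ?thesis using CA[of H] by blast
    qed
    moreover have "\<Union>C \<subseteq> T \<times> T" by (rule Union_least) (use CA in blast)
    ultimately show "\<Union>C \<in> ?A" by simp
  qed
  then obtain M where "M \<in> ?A" and maxA: "\<forall>H\<in>?A. M \<subseteq> H \<longrightarrow> H = M" by (rule bexE)
  then have M: "embedding_graph M" "G \<subseteq> M" "M \<subseteq> T \<times> T" by simp_all
  have max: "H = M" if "embedding_graph H" "G \<subseteq> H" "H \<subseteq> T \<times> T" "M \<subseteq> H" for H
    using maxA that by simp
  note D = embedding_graphD[OF M(1)]
  have Tf: "subfield T L" unfolding T using pyth_closure_subfield[OF F] .
  have "T \<subseteq> Domain M"
    unfolding T
  proof (rule pyth_closure_minimal[OF D(2)])
    show "F \<subseteq> Domain M" using G(2) M(2) by blast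
    fix a b c assume ab: "a \<in> Domain M" "b \<in> Domain M" "c \<in> carrier L" "c \<otimes> c = a \<otimes> a \<oplus> b \<otimes> b"
    then obtain a' b' where ab': "(a, a') \<in> M" "(b, b') \<in> M" by blast
    have mT: "a \<in> T" "b \<in> T" "a' \<in> T" "b' \<in> T" using ab' M(3) by auto
    have "a' \<otimes> a' \<oplus> b' \<otimes> b' \<in> carrier L" using mT subfieldE(3)[OF Tf] by auto
    then obtain c' where c': "c' \<in> carrier L" "c' \<otimes> c' = a' \<otimes> a' \<oplus> b' \<otimes> b'"
      using exists_square_root by blast
    have sq: "(c \<otimes> c, c' \<otimes> c') \<in> M"
      unfolding ab(4) c'(2) using D(4)[OF D(5)[OF ab'(1) ab'(1)] D(5)[OF ab'(2) ab'(2)]] .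
    have cT: "c \<in> T" "c' \<in> T"
      using pyth_closure_sqrt[OF F _ _ ab(3,4)] pyth_closure_sqrt[OF F _ _ c'] mT unfolding T by auto
    show "c \<in> Domain M"
    proof (rule ccontr)
      assume nc: "c \<notin> Domain M"
      let ?M = "{(a \<oplus> b \<otimes> c, a' \<oplus> b' \<otimes> c') | a a' b b'. (a, a') \<in> M \<and> (b, b') \<in> M}"
      note e = embedding_graph_extend[OF M(1) ab(3) c'(1) nc sq]
      have "?M \<subseteq> T \<times> T"
      proof clarify
        fix u u' v v' assume "(u, u') \<in> M" "(v, v') \<in> M"
        then have "u \<in> T" "u' \<in> T" "v \<in> T" "v' \<in> T" using M(3) by auto
        then show "u \<oplus> v \<otimes> c \<in> T \<and> u' \<oplus> v' \<otimes> c' \<in> T"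
          using cT subringE(6,7)[OF subfieldE(1)[OF Tf]] by simp
      qed
      then have "?M = M" using max[OF e(1)] e(2) M(2) by blast
      then show False using e(3) nc by blast
    qed
  qed
  then have "Domain M = T" using M(3) by blast
  then obtain h where h: "subfield_endo L T h" "\<And>x y. (x, y) \<in> M \<Longrightarrow> h x = y"
    using embedding_graph_endo[OF M(1) _ M(3)] by metis
  show ?thesis by (rule that[OF h(1)]) (use h(2) M(2) in blast)
qed

end

subsection \<open>Chains of subfields and conjugation\<close>

context field
begin

text \<open>A vector in the span of the later ones makes the dimension fall below the length; if
  this never happens, the list is independent.\<close>

lemma Span_dimension_le:
  assumes "subfield K R" "set Us \<subseteq> carrier R"
  shows "\<exists>m\<le>length Us. dimension m K (Span K Us) \<and> (m = length Us \<longrightarrow> independent K Us)"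
  using assms(2)
proof (induction Us)
  case Nil
  then show ?case by auto
next
  case (Cons u Us)
  then obtain m where m: "m \<le> length Us" "dimension m K (Span K Us)"
    "m = length Us \<longrightarrow> independent K Us" by auto
  have u: "u \<in> carrier R" "set Us \<subseteq> carrier R" using Cons.prems by auto
  show ?case
  proof (cases "u \<in> Span K Us")
    case True
    then have "set (u # Us) \<subseteq> Span K Us" using Span_base_incl[OF assms(1) u(2)] by simp
    then have "Span K (u # Us) = Span K Us"
      using mono_Span_subset[OF assms(1) _ u(2)] mono_Span[OF assms(1) u(2,1)] by blast
    then have "dimension m K (Span K (u # Us))" using m(2) by metis
    then show ?thesis using m(1) by (intro exI[of _ m]) auto
  next
    case False
    have "dimension (Suc m) K (Span K (u # Us))" using Suc_dim[OF u(1) False m(2)] by simp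
    moreover have "Suc m = length (u # Us) \<longrightarrow> independent K (u # Us)"
      using li_Cons[OF u(1) False] m(3) by simp
    ultimately show ?thesis using m(1) by (intro exI[of _ "Suc m"]) auto
  qed
qed

lemma spanning_list_independent:
  assumes "subfield K R" "set Us \<subseteq> carrier R" "dimension (length Us) K (Span K Us)"
  shows "independent K Us"
  using Span_dimension_le[OF assms(1,2)] dimension_is_inj[OF assms(1) assms(3)] by metis

lemma subfield_Union_chain:
  assumes sub: "\<And>k::nat. subfield (S k) R" and mono: "\<And>k. S k \<subseteq> S (Suc k)"
  shows "subfield (\<Union>k. S k) R"
proof -
  have le: "S i \<subseteq> S j" if "i \<le> j" for i j using lift_Suc_mono_le[of S, OF mono that] .
  have two: "\<exists>k. x \<in> S k \<and> y \<in> S k" if xy: "x \<in> (\<Union>k. S k)" "y \<in> (\<Union>k. S k)" for x y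
  proof -
    obtain i j where "x \<in> S i" "y \<in> S j" using xy by blast
    then have "x \<in> S (max i j)" "y \<in> S (max i j)" using le[of i "max i j"] le[of j "max i j"] by auto
    then show ?thesis by blast
  qed
  show ?thesis
  proof (rule subfieldI'[OF subringI])
    show "(\<Union>k. S k) \<subseteq> carrier R" using subfieldE(3)[OF sub] by blast
    show "\<one> \<in> (\<Union>k. S k)" using subringE(3)[OF subfieldE(1)[OF sub]] by blast
    show "\<ominus> x \<in> (\<Union>k. S k)" if x: "x \<in> (\<Union>k. S k)" for x
    proof -
      obtain k where "x \<in> S k" using x by blast
      then have "\<ominus> x \<in> S k" using subringE(5)[OF subfieldE(1)[OF sub]] by simp
      then show ?thesis by blast
    qed
    show "x \<otimes> y \<in> (\<Union>k. S k)" "x \<oplus> y \<in> (\<Union>k. S k)"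
      if xy: "x \<in> (\<Union>k. S k)" "y \<in> (\<Union>k. S k)" for x y
    proof -
      obtain k where "x \<in> S k" "y \<in> S k" using two[OF xy] by blast
      then have "x \<otimes> y \<in> S k" "x \<oplus> y \<in> S k" using subringE(6,7)[OF subfieldE(1)[OF sub]] by simp_all
      then show "x \<otimes> y \<in> (\<Union>k. S k)" "x \<oplus> y \<in> (\<Union>k. S k)" by blast+
    qed
    show "inv x \<in> (\<Union>k. S k)" if x: "x \<in> (\<Union>k. S k) - {\<zero>}" for x
    proof -
      obtain k where "x \<in> S k - {\<zero>}" using x by blast
      then have "inv x \<in> S k" using subfield_m_inv(1)[OF sub] by simp
      then show ?thesis by blast
    qed
  qed
qed

text \<open>A linear relation has finitely many coefficients, and these already lie in a single
  \<open>S k\<close>.\<close>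

lemma independent_Union_chain:
  assumes sub: "\<And>k::nat. subfield (S k) R" and mono: "\<And>k. S k \<subseteq> S (Suc k)"
    and ind: "\<And>k. independent (S k) Us"
  shows "independent (\<Union>k. S k) Us"
proof (rule ccontr)
  assume dep: "dependent (\<Union>k. S k) Us"
  have le: "S i \<subseteq> S j" if "i \<le> j" for i j using lift_Suc_mono_le[of S, OF mono that] .
  obtain Ks where Ks: "length Ks = length Us" "combine Ks Us = \<zero>" "set Ks \<subseteq> (\<Union>k. S k)"
    "set Ks \<noteq> {\<zero>}"
    using dependent_imp_non_trivial_combine[OF subfield_Union_chain[of S, OF sub mono]
        independent_in_carrier[OF ind] dep] by blast
  have "\<exists>k. set Ks \<subseteq> S k"
    using Ks(3)
  proof (induction Ks)
    case (Cons a Ks)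
    then obtain i j where "a \<in> S i" "set Ks \<subseteq> S j" by auto
    then have "set (a # Ks) \<subseteq> S (max i j)" using le[of i "max i j"] le[of j "max i j"] by auto
    then show ?case by blast
  qed simp
  then obtain k where k: "set Ks \<subseteq> S k" by blast
  have "set Ks \<subseteq> {\<zero>}"
    using independent_imp_trivial_combine[OF sub ind k Ks(2)] Ks(1) by simp
  then have "Ks = []" using Ks(4) by (cases Ks) auto
  then show False using Ks(1) dep by simp
qed

text \<open>Here (y + a)^2 = y^2 + a^2, so sums of squares are squares. A non-pythagorean base field
  thus allows division by 2.\<close>

lemma char_two_pythagorean:
  assumes "subfield K R" "\<one> \<oplus> \<one> = \<zero>"
  shows "pythagorean R K"
  unfolding pythagorean_def
proof (intro allI impI)
  fix s assume "is_sum_of_squares R K s"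
  then show "\<exists>y\<in>K. s = y \<otimes> y"
    using subfieldE(3)[OF assms(1)]
  proof (induction rule: is_sum_of_squares_induct)
    case zero
    have "\<zero> = \<zero> \<otimes> \<zero>" by simp
    then show ?case using subringE(2)[OF subfieldE(1)[OF assms(1)]] by blast
  next
    case (add_square s a)
    then obtain y where y: "y \<in> K" "s = y \<otimes> y" by blast
    have c: "y \<in> carrier R" "a \<in> carrier R"
      using y add_square.hyps(2) subfieldE(3)[OF assms(1)] by auto
    have "(y \<oplus> a) \<otimes> (y \<oplus> a) = y \<otimes> y \<oplus> a \<otimes> a \<oplus> (\<one> \<oplus> \<one>) \<otimes> (y \<otimes> a)" using c by algebra
    then have "s \<oplus> a \<otimes> a = (y \<oplus> a) \<otimes> (y \<oplus> a)" using assms(2) y(2) c by simp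
    then show ?case
      using subringE(7)[OF subfieldE(1)[OF assms(1)] y(1) add_square.hyps(2)] by blast
  qed
qed

lemma compositum_subfield:
  assumes "subfield A R" "subfield B R"
  shows "subfield (compositum R A B) R" and "A \<subseteq> compositum R A B" and "B \<subseteq> compositum R A B"
proof -
  have c: "A \<union> B \<subseteq> carrier R" using subfieldE(3) assms by blast
  show "subfield (compositum R A B) R"
    unfolding compositum_def using generate_field_is_subfield[OF c] .
  have "A \<union> B \<subseteq> compositum R A B"
    unfolding compositum_def using generate_fieldE(2)[OF c refl] .
  then show "A \<subseteq> compositum R A B" "B \<subseteq> compositum R A B" by auto
qed

lemma compositum_eqI:
  assumes "subfield A R" "subfield B R" "subfield M R" "A \<subseteq> M" "B \<subseteq> M"
    and "M = Span A Us" "set Us \<subseteq> B"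
  shows "compositum R A B = M"
proof
  have c: "A \<union> B \<subseteq> carrier R" using subfieldE(3) assms(1,2) by blast
  show "compositum R A B \<subseteq> M"
    unfolding compositum_def using generate_field_min_subfield1[OF c assms(3)] assms(4,5) by blast
  note C = compositum_subfield[OF assms(1,2)]
  show "M \<subseteq> compositum R A B"
    unfolding assms(6)
    using Span_subset_subring[OF assms(1) subfieldE(1)[OF C(1)] C(2)] assms(7) C(3) by blast
qed

end

section \<open>Conjugation on \<open>F\<close> and on a square root at once\<close>

context odd_prime_galois
begin

lemma separable_mem: "y \<in> F \<Longrightarrow> separable_element L E y"
  using galois unfolding galois_extension_def by blast

text \<open>The minimal polynomial has p > 1 roots counted with multiplicity, and by separability
  \<open>x\<close> accounts for at most one of them.\<close>

lemma exists_conjugate: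
  assumes x: "x \<in> F" "x \<notin> E"
  obtains y where "y \<in> F" "y \<noteq> x" "y \<in> carrier L" "eval (Irr E x) y = \<zero>"
proof -
  have xc: "x \<in> carrier L" using x subfieldE(3)[OF F] by blast
  note g = generator[OF x]
  let ?f = "Irr E x"
  have fE: "?f \<in> carrier (E[X])" using IrrE(1)[OF E xc g(1)] .
  have f: "?f \<in> carrier (poly_ring L)" using carrier_polynomial_shell[OF subfieldE(1)[OF E] fE] .
  have size: "size (roots ?f) = p" using roots_over_carrier[OF f] g(3) unfolding splitted_def by simp
  have "\<exists>y\<in>#roots ?f. y \<noteq> x"
  proof (rule ccontr)
    assume "\<not> ?thesis"
    then have "roots ?f = replicate_mset p x"
      using size set_mset_subset_singletonD[of "roots ?f" x] by auto
    then have "alg_mult ?f x = p" using alg_mult_eq_count_roots[OF f] by simp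
    moreover have "alg_mult ?f x \<le> 1"
      using separable_mem[OF x(1)] xc unfolding separable_element_def by blast
    ultimately show False using prime_gt_1_nat[OF prime_p] by simp
  qed
  then obtain y where y: "y \<noteq> x" "is_root ?f y" using roots_mem_iff_is_root[OF f] by blast
  then have "y \<in> carrier L" "eval ?f y = \<zero>" unfolding is_root_def by auto
  then show ?thesis using that y(1) root_Irr_mem[OF x(1)] by blast
qed

text \<open>Such a \<open>c\<close> in \<open>F\<close> would generate \<open>F\<close>, which would
  then have degree 2 instead of an odd degree.\<close>

lemma square_root_not_mem:
  assumes "c \<in> carrier L" "c \<otimes> c \<in> E" "c \<notin> E"
  shows "c \<notin> F"
proof
  assume "c \<in> F"
  then have "dimension 2 E F"
    using dimension_simple_extension_square_root[OF E assms] generator(2)[OF _ assms(3)] by simp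
  then have "p = 2" using dimension_is_inj[OF E dim_p] by blast
  then show False using odd_p by simp
qed

text \<open>The map is built in three stages: on \<open>F\<close> by sending a generator to another
  conjugate, on \<open>F(c)\<close> by changing the sign of \<open>c\<close>, which is possible as
  \<open>c\<close> is not in \<open>F\<close>, and finally on the whole closure by the extension
  lemma.\<close>

lemma exists_conjugating_endo:
  assumes c: "c \<in> pyth_closure L F" "c \<otimes> c \<in> E" "c \<notin> E"
  obtains h x where "subfield_endo L (pyth_closure L F) h" "x \<in> F" "h x \<in> F" "h x \<noteq> x"
    "\<And>k. k \<in> E \<Longrightarrow> h k = k" "h c = \<ominus> c"
proof -
  let ?T = "pyth_closure L F"
  note Tf = pyth_closure_subfield[OF F]
  have FT: "F \<subseteq> ?T" using pyth_closure_incl[of F L] .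
  have cc: "c \<in> carrier L" using c(1) subfieldE(3)[OF Tf] by blast
  obtain x where x: "x \<in> F" "x \<notin> E" using exists_generator .
  have xc: "x \<in> carrier L" using x subfieldE(3)[OF F] by blast
  note g = generator[OF x]
  obtain y where y: "y \<in> F" "y \<noteq> x" "y \<in> carrier L" "eval (Irr E x) y = \<zero>"
    using exists_conjugate[OF x] .
  define G where "G = {(eval q x, eval q y) | q. q \<in> carrier (E[X])}"
  note G = embedding_graph_simple_extension[OF E xc g(1) y(3,4), folded G_def]
  have domG: "Domain G = F" using G(2) g(2) by simp
  have "simple_extension E y \<subseteq> F" using simple_extension_subring_incl[OF subfieldE(1)[OF F] E_F y(1)] .
  then have GF: "G \<subseteq> F \<times> F" using G(5) g(2) by blast
  define G' where
    "G' = {(a \<oplus> b \<otimes> c, a' \<oplus> b' \<otimes> \<ominus> c) | a a' b b'. (a, a') \<in> G \<and> (b, b') \<in> G}"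
  have "\<ominus> c \<otimes> \<ominus> c = c \<otimes> c" using cc by algebra
  then have sq: "(c \<otimes> c, \<ominus> c \<otimes> \<ominus> c) \<in> G" using G(4)[OF c(2)] by simp
  have nc: "c \<notin> Domain G" using square_root_not_mem[OF cc c(2,3)] domG by simp
  note G' = embedding_graph_extend[OF G(1) cc a_inv_closed[OF cc] nc sq, folded G'_def]
  have F': "F \<subseteq> Domain G'" using domG G'(2) by blast
  have mc: "\<ominus> c \<in> ?T" using c(1) subringE(5)[OF subfieldE(1)[OF Tf]] by blast
  have GT: "G' \<subseteq> ?T \<times> ?T"
    unfolding G'_def
  proof clarify
    fix u u' v v' assume "(u, u') \<in> G" "(v, v') \<in> G"
    then have "u \<in> ?T" "u' \<in> ?T" "v \<in> ?T" "v' \<in> ?T" using GF FT by auto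
    then show "u \<oplus> v \<otimes> c \<in> ?T \<and> u' \<oplus> v' \<otimes> \<ominus> c \<in> ?T"
      using c(1) mc subringE(6,7)[OF subfieldE(1)[OF Tf]] by simp
  qed
  obtain h where h: "subfield_endo L ?T h" "\<And>u v. (u, v) \<in> G' \<Longrightarrow> h u = v"
    by (rule embedding_graph_pyth_closure_endo[OF F refl G'(1) F' GT]) blast
  have hG: "h u = v" if "(u, v) \<in> G" for u v using h(2) G'(2) that by blast
  have "h x = y" using hG[OF G(3)] .
  moreover have "h k = k" if "k \<in> E" for k using hG[OF G(4)[OF that]] .
  moreover have "h c = \<ominus> c" using h(2)[OF G'(3)] .
  ultimately show ?thesis using that[OF h(1) x(1)] y(1,2) by simp
qed

text \<open>The witness is the pythagorean closure of the compositum of \<open>E0\<close> and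
  \<open>F\<close>, a finite extension of degree \<open>p\<close>. It is not purely inseparable:
  \<open>F\<close> is not contained in the lower closure, and an element of \<open>F\<close> outside
  it has there a minimal polynomial dividing the one over \<open>E\<close>, hence with simple roots
  only.\<close>

lemma not_hereditarily_non_pythagorean:
  assumes E0: "algebraic_extension L E E0"
    and comp: "pyth_closure L (compositum L E0 F) = compositum L (pyth_closure L E0) F"
    and dim: "dimension p (pyth_closure L E0) (pyth_closure L (compositum L E0 F))"
  shows "\<not> hereditarily_non_pythagorean L (pyth_closure L E0)"
proof -
  let ?P = "pyth_closure L E0" and ?F0 = "compositum L E0 F"
  let ?M = "pyth_closure L ?F0"
  have E0f: "subfield E0 L" "E \<subseteq> E0"
    using E0 unfolding algebraic_extension_def field_extension_def by auto
  note C = compositum_subfield[OF E0f(1) F]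
  note P = pyth_closure_subfield[OF E0f(1)] and M = pyth_closure_subfield[OF C(1)]
  note C' = compositum_subfield[OF P F]
  have EP: "E \<subseteq> ?P" using E0f(2) pyth_closure_incl[of E0 L] by blast
  have PM: "?P \<subseteq> ?M" unfolding comp using C'(2) .
  have neq: "?M \<noteq> ?P"
  proof
    assume "?M = ?P"
    then have "p = 1"
      using dim dimension_is_inj[OF P _ dimension_one[OF P]] by metis
    then show False using prime_p by simp
  qed
  have "\<not> F \<subseteq> ?P"
  proof
    assume "F \<subseteq> ?P"
    then have "?M = ?P"
      unfolding comp using compositum_eqI[OF P F P subset_refl _ Span_one(2)[OF P, symmetric]]
        subringE(3)[OF subfieldE(1)[OF F]] by simp
    then show False using neq by simp
  qed
  then obtain y where y: "y \<in> F" "y \<notin> ?P" by blast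
  have yc: "y \<in> carrier L" using y(1) subfieldE(3)[OF F] by blast
  have sep: "(algebraic over E) y" "\<And>a. a \<in> carrier L \<Longrightarrow> alg_mult (Irr E y) a \<le> 1"
    using separable_mem[OF y(1)] unfolding separable_element_def by auto
  have alg: "(algebraic over ?P) y" using algebraic_mono[OF EP sep(1)] .
  have "Irr E y \<in> carrier (E[X])" using IrrE(1)[OF E yc sep(1)] .
  then have IP: "Irr E y \<in> carrier (?P[X])"
    using EP unfolding univ_poly_def polynomial_def by auto
  have In: "Irr E y \<noteq> []"
    using pirreducibleE(1)[OF subfieldE(1)[OF E] IrrE(1,2)[OF E yc sep(1)]] .
  have div: "Irr ?P y pdivides Irr E y"
    using Irr_minimal[OF P yc alg IP IrrE(4)[OF E yc sep(1)]] .
  have r: "Irr ?P y \<in> carrier (poly_ring L)" "Irr E y \<in> carrier (poly_ring L)"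
    using carrier_polynomial_shell[OF subfieldE(1)[OF P]] IP IrrE(1)[OF P yc alg] by auto
  have "alg_mult (Irr ?P y) a \<le> alg_mult (Irr E y) a" for a
    unfolding alg_mult_eq_count_roots[OF r(1)] alg_mult_eq_count_roots[OF r(2)]
    using pdivides_imp_roots_incl[OF r In div] by (simp add: mset_subset_eq_count)
  then have "alg_mult (Irr ?P y) a \<le> 1" if "a \<in> carrier L" for a
    using sep(2)[OF that] order_trans by blast
  then have "separable_element L ?P y" using alg unfolding separable_element_def by simp
  moreover have "y \<in> ?M" using y(1) C(3) pyth_closure_incl[of ?F0 L] by blast
  ultimately have "\<not> purely_inseparable L ?P ?M" using y(2) unfolding purely_inseparable_def by blast
  moreover have "pythagorean L ?M" using pythagorean_pyth_closure[OF C(1)] .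
  moreover have "field_extension L ?P ?M" unfolding field_extension_def using P M PM by simp
  ultimately show ?thesis
    using neq finite_dimensionI[OF dim] unfolding hereditarily_non_pythagorean_def by blast
qed

end

subsection \<open>The fixed field of a conjugating endomorphism\<close>

locale conjugating_endo =
  odd_prime_galois L E F p + subfield_endo L "pyth_closure L F" h
  for L (structure) and E F :: "'a set" and p :: nat and h :: "'a \<Rightarrow> 'a" +
  fixes x c :: 'a
  assumes two_nonzero: "\<one> \<oplus> \<one> \<noteq> \<zero>"
    and x_mem: "x \<in> F" and hx_mem: "h x \<in> F" and hx: "h x \<noteq> x"
    and h_base: "k \<in> E \<Longrightarrow> h k = k"
    and c_mem: "c \<in> pyth_closure L F" and c_nonzero: "c \<noteq> \<zero>" and hc: "h c = \<ominus> c"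
    and c_square: "is_sum_of_squares L E (c \<otimes> c)"
begin

abbreviation "T \<equiv> pyth_closure L F"
abbreviation "Fix m \<equiv> fixed_elements T (h ^^ m)"

lemma F_T: "F \<subseteq> T" using pyth_closure_incl[of F L] .

lemma E_T: "E \<subseteq> T" using E_F F_T by blast

lemma x_T: "x \<in> T" using x_mem F_T by blast

lemma x_not_mem: "x \<notin> E" using h_base hx by blast

lemmas x_generator = generator[OF x_mem x_not_mem]

lemma Fix_subfield: "subfield (Fix m) L"
  using subfield_endo.fixed_elements_subfield[OF iterate] .

lemma Fix_T: "Fix m \<subseteq> T" unfolding fixed_elements_def by blast

lemma iterate_base: "k \<in> E \<Longrightarrow> (h ^^ m) k = k"
  by (induction m) (simp_all add: h_base)

lemma E_Fix: "E \<subseteq> Fix m"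
  using E_T iterate_base unfolding fixed_elements_def by blast

text \<open>As \<open>F = E(x)\<close> and \<open>h\<close> fixes \<open>E\<close>, the image of
  \<open>F\<close> is generated by \<open>h x\<close>, which lies in \<open>F\<close>.\<close>

lemma endo_F: "subfield_endo L F h"
proof (intro subfield_endo.intro subfield_endo_axioms.intro field_axioms F)
  fix y assume y: "y \<in> F"
  have xc: "x \<in> carrier L" "h x \<in> carrier L" using x_mem hx_mem subfieldE(3)[OF F] by auto
  have "y \<in> (\<lambda>q. eval q x) ` carrier (E[X])"
    using y x_generator(2) simple_extension_as_eval_img[OF subfieldE(3)[OF E] xc(1)] by simp
  then obtain q where q: "q \<in> carrier (E[X])" "y = eval q x" by blast
  have qE: "set q \<subseteq> E" using q(1) polynomial_incl by (simp add: univ_poly_carrier[symmetric])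
  have "map h q = q" using qE h_base by (auto intro: map_idI)
  then have "h y = eval q (h x)" using h_eval[of q x] qE E_T x_T q(2) by auto
  also have "\<dots> \<in> simple_extension E (h x)"
    unfolding simple_extension_as_eval_img[OF subfieldE(3)[OF E] xc(2)] using q(1) by (rule imageI)
  also have "\<dots> \<subseteq> F" using simple_extension_subring_incl[OF subfieldE(1)[OF F] E_F hx_mem] .
  finally show "h y \<in> F" .
qed (simp_all add: h_add h_mult h_one subsetD[OF F_T])

text \<open>A fixed element of \<open>F\<close> outside \<open>E\<close> would generate
  \<open>F\<close>, so \<open>h\<close> would fix \<open>x\<close> as well.\<close>

lemma fixed_elements_F: "fixed_elements F h = E"
proof
  interpret F: subfield_endo L F h using endo_F .
  show "E \<subseteq> fixed_elements F h" using E_F h_base unfolding fixed_elements_def by blast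
  show "fixed_elements F h \<subseteq> E"
  proof
    fix y assume y: "y \<in> fixed_elements F h"
    show "y \<in> E"
    proof (rule ccontr)
      assume n: "y \<notin> E"
      have "y \<in> F" using y unfolding fixed_elements_def by simp
      then have "F = simple_extension E y" using generator(2) n by simp
      also have "\<dots> \<subseteq> fixed_elements F h"
        using simple_extension_subring_incl[OF subfieldE(1)[OF F.fixed_elements_subfield]
            \<open>E \<subseteq> fixed_elements F h\<close> y] .
      finally show False using x_mem hx unfolding fixed_elements_def by blast
    qed
  qed
qed

lemma iterate_diff:
  assumes "(h ^^ i) x = (h ^^ j) x" "i \<le> j"
  shows "(h ^^ (j - i)) x = x"
proof -
  have "(h ^^ j) x = (h ^^ i) ((h ^^ (j - i)) x)"
    using assms(2) by (metis comp_apply funpow_add le_add_diff_inverse)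
  then show ?thesis
    using iterate_inj[of i] assms(1) iterate_closed[OF x_T] x_T unfolding inj_on_def by metis
qed

text \<open>The powers of \<open>x\<close> below the orbit length form a basis of \<open>F\<close> over \<open>E\<close>, so the orbit
  has length \<open>p\<close>.\<close>

lemma orbit_length: "(h ^^ i) x = x \<longleftrightarrow> p dvd i"
proof -
  interpret F: subfield_endo L F h using endo_F .
  have p1: "p > 1" using prime_gt_1_nat[OF prime_p] .
  have xc: "x \<in> carrier L" using x_mem subfieldE(3)[OF F] by blast
  \<comment> \<open>If no iterate returned to \<open>x\<close>, then p + 1 distinct conjugates would
    make p + 1 powers of \<open>x\<close> independent in a space of dimension
    \<open>p\<close>.\<close>
  have ex: "\<exists>n>0. (h ^^ n) x = x"
  proof (rule ccontr)
    assume none: "\<not> ?thesis"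
    have "inj_on (\<lambda>i. (h ^^ i) x) {..<Suc p}"
    proof (rule linorder_inj_onI)
      fix i j :: nat assume "i < j"
      then show "(h ^^ i) x \<noteq> (h ^^ j) x"
        using iterate_diff[of i j] none by (metis less_imp_le zero_less_diff)
    qed auto
    then have "independent E (exp_base x (Suc p))"
      using F.independent_powers[OF x_mem] fixed_elements_F by simp
    moreover have "set (exp_base x (Suc p)) \<subseteq> F"
      using F.h_pow[OF x_mem] unfolding exp_base_def by auto
    ultimately have "length (exp_base x (Suc p)) \<le> p"
      using independent_length_le_dimension[OF E dim_p] by blast
    then show False unfolding exp_base_def by simp
  qed
  define n where "n = (LEAST n. n > 0 \<and> (h ^^ n) x = x)"
  have n: "n > 0" "(h ^^ n) x = x" using LeastI_ex[OF ex] unfolding n_def by auto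
  have least: "n \<le> m" if "m > 0" "(h ^^ m) x = x" for m
    unfolding n_def using that by (intro Least_le) simp
  have inj: "inj_on (\<lambda>i. (h ^^ i) x) {..<n}"
  proof (rule linorder_inj_onI)
    fix i j assume ij: "i < j" "i \<in> {..<n}" "j \<in> {..<n}"
    show "(h ^^ i) x \<noteq> (h ^^ j) x"
    proof
      assume "(h ^^ i) x = (h ^^ j) x"
      then have "n \<le> j - i" using iterate_diff[of i j] least[of "j - i"] ij(1) by simp
      then show False using ij by simp
    qed
  qed auto
  interpret n: subfield_endo L F "h ^^ n" using F.iterate .
  have "x \<in> fixed_elements F (h ^^ n)" using x_mem n(2) unfolding fixed_elements_def by simp
  moreover have "E \<subseteq> fixed_elements F (h ^^ n)"
    using E_F iterate_base unfolding fixed_elements_def by blast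
  ultimately have "simple_extension E x \<subseteq> fixed_elements F (h ^^ n)"
    using simple_extension_subring_incl[OF subfieldE(1)[OF n.fixed_elements_subfield]] by blast
  then have "fixed_elements F (h ^^ n) = F"
    using x_generator(2) n.fixed_elements_incl by blast
  then have "Span E (exp_base x n) = F"
    using F.fixed_elements_iterate_eq_Span[OF x_mem inj n] fixed_elements_F by simp
  moreover have "independent E (exp_base x n)"
    using F.independent_powers[OF x_mem inj] fixed_elements_F by simp
  ultimately have "dimension (length (exp_base x n)) E F" using dimensionI[OF E] by blast
  then have np: "n = p"
    using dimension_is_inj[OF E _ dim_p] unfolding exp_base_def by simp
  have mult: "(h ^^ (p * k)) x = x" for k
  proof (induction k)
    case (Suc k)
    then show ?case using n(2) unfolding np by (simp add: funpow_add)
  qed simp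
  show ?thesis
  proof
    assume i: "(h ^^ i) x = x"
    have "(h ^^ i) x = (h ^^ (i mod p)) ((h ^^ (p * (i div p))) x)"
      by (metis comp_apply funpow_add mod_mult_div_eq)
    then have "(h ^^ (i mod p)) x = x" using i mult by simp
    then have "i mod p = 0"
      using least[of "i mod p"] np p1 by (metis gr0I mod_less_divisor not_le zero_less_one less_trans)
    then show "p dvd i" by auto
  next
    assume "p dvd i"
    then show "(h ^^ i) x = x" using mult by auto
  qed
qed

lemma
  assumes m: "coprime m p"
  shows Fix_independent: "independent (Fix m) (exp_base x p)"
    and Fix_Span: "Fix (m * p) = Span (Fix m) (exp_base x p)"
proof -
  interpret m: subfield_endo L T "h ^^ m" using iterate .
  have it: "((h ^^ m) ^^ i) x = (h ^^ (m * i)) x" for i by (simp add: funpow_mult)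
  \<comment> \<open>Multiplication by \<open>m\<close> is injective modulo the orbit length
    \<open>p\<close>, so \<open>h ^^ m\<close> still moves \<open>x\<close> through \<open>p\<close>
    distinct conjugates.\<close>
  have inj: "inj_on (\<lambda>i. ((h ^^ m) ^^ i) x) {..<p}"
    unfolding it
  proof (rule linorder_inj_onI)
    fix i j assume ij: "i < j" "i \<in> {..<p}" "j \<in> {..<p}"
    show "(h ^^ (m * i)) x \<noteq> (h ^^ (m * j)) x"
    proof
      assume "(h ^^ (m * i)) x = (h ^^ (m * j)) x"
      then have "p dvd m * j - m * i" using iterate_diff orbit_length ij(1) by simp
      then have "p dvd m * (j - i)" by (simp add: diff_mult_distrib2)
      then have "p dvd j - i" using m by (simp add: coprime_commute coprime_dvd_mult_right_iff)
      then show False using ij by (auto dest: dvd_imp_le)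
    qed
  qed auto
  show "independent (Fix m) (exp_base x p)" using m.independent_powers[OF x_T inj] .
  have "((h ^^ m) ^^ p) x = x" unfolding it using orbit_length by simp
  then have "fixed_elements T ((h ^^ m) ^^ p) = Span (Fix m) (exp_base x p)"
    using m.fixed_elements_iterate_eq_Span[OF x_T inj] prime_gt_0_nat[OF prime_p] by blast
  then show "Fix (m * p) = Span (Fix m) (exp_base x p)" by (simp add: funpow_mult)
qed

lemma F_Fix: "F \<subseteq> Fix (m * p)"
proof -
  have "x \<in> Fix (m * p)" using orbit_length[of "m * p"] x_T unfolding fixed_elements_def by simp
  then show ?thesis
    using simple_extension_subring_incl[OF subfieldE(1)[OF Fix_subfield] E_Fix] x_generator(2) by metis
qed

lemma Fix_mono: "Fix m \<subseteq> Fix (m * k)"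
  using fixed_elements_iterate_mono .

lemma Fix_chain:
  shows "subfield (\<Union>k. Fix (j * 2 ^ k)) L" and "Fix (j * 2 ^ k) \<subseteq> Fix (j * 2 ^ Suc k)"
proof -
  show mono: "Fix (j * 2 ^ k) \<subseteq> Fix (j * 2 ^ Suc k)" for k
    using Fix_mono[of "j * 2 ^ k" 2] by (simp add: mult_ac)
  show "subfield (\<Union>k. Fix (j * 2 ^ k)) L"
    using subfield_Union_chain[of "\<lambda>k. Fix (j * 2 ^ k)", OF Fix_subfield mono] .
qed

text \<open>With \<open>g = h ^^ m\<close>, an element \<open>a\<close> fixed by \<open>g \<circ> g\<close> is the mean of \<open>a + g a\<close>, which \<open>g\<close>
  fixes, and \<open>a - g a\<close>, whose square \<open>g\<close> fixes.\<close>

lemma Fix_double_subset: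
  assumes K: "subfield K L" "Fix m \<subseteq> pyth_closure L K"
  shows "Fix (m * 2) \<subseteq> pyth_closure L K"
proof
  let ?P = "pyth_closure L K"
  note P = pyth_closure_subfield[OF K(1)]
  note Pr = subfieldE(1)[OF P]
  interpret g: subfield_endo L T "h ^^ m" using iterate .
  let ?g = "h ^^ m"
  fix a assume "a \<in> Fix (m * 2)"
  then have a: "a \<in> T" "?g (?g a) = a"
    unfolding fixed_elements_def by (auto simp: mult_2_right funpow_add)
  have ac: "a \<in> carrier L" "?g a \<in> T" "?g a \<in> carrier L"
    using T_mem a(1) iterate_closed[OF a(1)] by auto
  have gm: "\<ominus> ?g a \<in> T" "?g (\<ominus> ?g a) = \<ominus> a"
    using g.h_minus[OF ac(2)] a(2) subringE(5)[OF T_ring ac(2)] by simp_all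
  define u where "u = a \<oplus> ?g a"
  define v where "v = a \<ominus> ?g a"
  have vT: "v \<in> T" unfolding v_def a_minus_def using subringE(7)[OF T_ring a(1) gm(1)] .
  have uT: "u \<in> T" unfolding u_def using subringE(7)[OF T_ring a(1) ac(2)] .
  have uv: "u \<in> carrier L" "v \<in> carrier L" using uT vT T_mem by auto
  have "?g u = u" unfolding u_def using g.h_add[OF a(1) ac(2)] a(2) ac by (simp add: a_comm)
  then have "u \<in> Fix m" using uT unfolding fixed_elements_def by simp
  then have uP: "u \<in> ?P" using K(2) by blast
  have "?g v = ?g a \<oplus> \<ominus> a" unfolding v_def a_minus_def using g.h_add[OF a(1) gm(1)] gm(2) by simp
  also have "\<dots> = \<ominus> v" unfolding v_def using ac by algebra
  finally have "?g (v \<otimes> v) = \<ominus> v \<otimes> \<ominus> v" using g.h_mult[OF vT vT] by simp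
  also have "\<dots> = v \<otimes> v" using uv by algebra
  finally have "v \<otimes> v \<in> Fix m"
    using subringE(6)[OF T_ring vT vT] unfolding fixed_elements_def by simp
  \<comment> \<open>This uses that v lies in \<open>T\<close>: a square root of an element of
    \<open>Fix m\<close> in the algebraic closure need not have a sum of squares as its
    square.\<close>
  then have "is_sum_of_squares L (Fix m) (v \<otimes> v)"
    using square_in_pyth_closure_is_sum_of_squares[OF Fix_subfield E_Fix two_nonzero vT] by simp
  then have vP: "v \<in> ?P"
    using pyth_closure_sqrt_sum_of_squares[OF K(1) is_sum_of_squares_mono[OF _ K(2)] uv(2)] by blast
  have "(\<one> \<oplus> \<one>) \<otimes> a = u \<oplus> v" unfolding u_def v_def using ac by algebra
  also have "\<dots> \<in> ?P" using subringE(7)[OF Pr uP vP] .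
  finally show "a \<in> ?P"
    using subfield_m_inv_simprule[OF P _ ac(1), of "\<one> \<oplus> \<one>"] two_nonzero subringE(3,7)[OF Pr] by simp
qed

text \<open>The union is closed under the required roots: if g fixes d^2, then g maps d to d or -d,
  so d is fixed at the next level. Conversely, each level is contained in the closure by repeated
  doubling.\<close>

lemma pyth_closure_Fix: "pyth_closure L (Fix j) = (\<Union>k. Fix (j * 2 ^ k))"
proof
  let ?U = "\<Union>k. Fix (j * 2 ^ k)"
  note U = Fix_chain(1)[of j]
  show "pyth_closure L (Fix j) \<subseteq> ?U"
  proof (rule pyth_closure_minimal[OF U])
    have "Fix j = Fix (j * 2 ^ 0)" by simp
    then show "Fix j \<subseteq> ?U" by blast
    fix a b d assume ab: "a \<in> ?U" "b \<in> ?U" "d \<in> carrier L" "d \<otimes> d = a \<otimes> a \<oplus> b \<otimes> b"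
    have dT: "d \<in> T" using pyth_closure_sqrt[OF F _ _ ab(3,4)] ab(1,2) Fix_T by blast
    have "d \<otimes> d \<in> ?U"
      unfolding ab(4) using ab(1,2) subringE(6,7)[OF subfieldE(1)[OF U]] by simp
    then obtain k where "d \<otimes> d \<in> Fix (j * 2 ^ k)" by blast
    then have k: "(h ^^ (j * 2 ^ k)) (d \<otimes> d) = d \<otimes> d" unfolding fixed_elements_def by simp
    interpret g: subfield_endo L T "h ^^ (j * 2 ^ k)" using iterate .
    let ?g = "h ^^ (j * 2 ^ k)"
    have "?g d = d \<or> ?g d = \<ominus> d"
      using square_eq_imp[of "?g d" d] k g.h_mult[OF dT dT] T_mem[OF g.h_closed[OF dT]] ab(3) by simp
    then have "?g (?g d) = d" using g.h_minus[OF dT] ab(3) by auto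
    then have "(h ^^ (j * 2 ^ Suc k)) d = d" by (simp add: mult_2 funpow_add distrib_left)
    then show "d \<in> ?U" using dT unfolding fixed_elements_def by blast
  qed
  show "?U \<subseteq> pyth_closure L (Fix j)"
  proof (rule UN_least)
    fix k :: nat
    show "Fix (j * 2 ^ k) \<subseteq> pyth_closure L (Fix j)"
    proof (induction k)
      case 0
      show ?case using pyth_closure_incl[of "Fix j" L] by simp
    next
      case (Suc k)
      have "j * 2 ^ Suc k = j * 2 ^ k * 2" by simp
      then show ?case using Fix_double_subset[OF Fix_subfield Suc.IH] by metis
    qed
  qed
qed

lemma coprime_two_power: "coprime (2 ^ k) p"
  using odd_p by simp

lemma powers_F: "set (exp_base x n) \<subseteq> F"
  using subfield_endo.h_pow[OF endo_F x_mem] unfolding exp_base_def by auto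

lemma compositum_Fix: "compositum L (Fix 1) F = Fix p"
  using compositum_eqI[OF Fix_subfield F Fix_subfield Fix_mono[of 1 p] _ _ powers_F]
    F_Fix[of 1] Fix_Span[of 1] by simp

text \<open>The same list of powers of \<open>x\<close> is a basis of \<open>Fix (2 ^ k * p)\<close>
  over \<open>Fix (2 ^ k)\<close> for every \<open>k\<close>, because \<open>2 ^ k\<close> is prime
  to \<open>p\<close>; hence it remains a basis after taking unions.\<close>

lemma pyth_closure_Fix_Span:
  shows "independent (pyth_closure L (Fix 1)) (exp_base x p)"
    and "pyth_closure L (Fix p) = Span (pyth_closure L (Fix 1)) (exp_base x p)"
proof -
  let ?P = "pyth_closure L (Fix 1)" and ?M = "pyth_closure L (Fix p)"
  note P = pyth_closure_subfield[OF Fix_subfield[of 1]]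
  note M = pyth_closure_subfield[OF Fix_subfield[of p]]
  have Peq: "?P = (\<Union>k. Fix (2 ^ k))" using pyth_closure_Fix[of 1] by simp
  have Meq: "?M = (\<Union>k. Fix (2 ^ k * p))" using pyth_closure_Fix[of p] by (simp add: mult.commute)
  show "independent ?P (exp_base x p)"
    unfolding Peq
    using independent_Union_chain[of "\<lambda>k. Fix (2 ^ k)", OF Fix_subfield]
      Fix_chain(2)[of 1] Fix_independent[OF coprime_two_power] by simp
  have FM: "F \<subseteq> ?M" using F_Fix[of 1] pyth_closure_incl[of "Fix p" L] by auto
  show "?M = Span ?P (exp_base x p)"
  proof
    show "?M \<subseteq> Span ?P (exp_base x p)"
      unfolding Meq
    proof (rule UN_least)
      fix k :: nat
      have "Fix (2 ^ k) \<subseteq> ?P" unfolding Peq by blast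
      then show "Fix (2 ^ k * p) \<subseteq> Span ?P (exp_base x p)"
        unfolding Fix_Span[OF coprime_two_power] by (rule Span_mono_field)
    qed
    have "?P \<subseteq> ?M"
      using pyth_closure_mono[OF Fix_subfield] Fix_mono[of 1 p] pyth_closure_incl[of "Fix p" L] by simp
    then show "Span ?P (exp_base x p) \<subseteq> ?M"
      using Span_subset_subring[OF P subfieldE(1)[OF M]] powers_F FM by blast
  qed
qed

text \<open>An independent list in \<open>F\<close> extends to a basis of \<open>F\<close> over
  \<open>E\<close>. This basis spans \<open>Fix p\<close> over \<open>Fix 1\<close>, whose degree is
  again \<open>p\<close>, so it has no redundant element.\<close>

lemma linearly_disjoint_Fix: "linearly_disjoint L E (Fix 1) F"
  unfolding linearly_disjoint_def
proof (intro allI impI, elim conjE)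
  fix Us assume Us: "set Us \<subseteq> F" "independent E Us"
  obtain Vs where Vs: "length (Vs @ Us) = p" "independent E (Vs @ Us)" "Span E (Vs @ Us) = F"
    using complete_base[OF E dim_p Us(2,1)] by blast
  let ?W = "Vs @ Us"
  have Wc: "set ?W \<subseteq> carrier L" using independent_in_carrier[OF Vs(2)] .
  have WF: "set ?W \<subseteq> F" using Span_base_incl[OF E Wc] Vs(3) by simp
  have "F \<subseteq> Span (Fix 1) ?W" using Span_mono_field[OF E_Fix] Vs(3) by blast
  then have "Fix p \<subseteq> Span (Fix 1) ?W"
    using mono_Span_subset[OF Fix_subfield _ Wc] powers_F Fix_Span[of 1] by (metis coprime_1_left mult_1 subset_trans)
  moreover have "Span (Fix 1) ?W \<subseteq> Fix p"
  proof (rule Span_subset_subring[OF Fix_subfield subfieldE(1)[OF Fix_subfield]])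
    show "Fix 1 \<subseteq> Fix p" using Fix_mono[of 1 p] by simp
    show "set ?W \<subseteq> Fix p" using subset_trans[OF WF F_Fix[of 1]] by simp
  qed
  moreover have "dimension p (Fix 1) (Fix p)"
    using dimensionI[OF Fix_subfield Fix_independent[of 1]] Fix_Span[of 1]
    by (simp add: exp_base_def)
  ultimately have "dimension (length ?W) (Fix 1) (Span (Fix 1) ?W)" by (metis Vs(1) subset_antisym)
  then have "independent (Fix 1) ?W" using spanning_list_independent[OF Fix_subfield Wc] by blast
  then show "independent (Fix 1) Us" using independent_split(1)[OF Fix_subfield] by blast
qed

text \<open>The square roots of c^2 are \<open>c\<close> and its negative, and \<open>h\<close>
  moves both because 2c is nonzero.\<close>

lemma not_pythagorean_Fix: "\<not> pythagorean L (Fix 1)"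
proof
  assume "pythagorean L (Fix 1)"
  then obtain y where y: "y \<in> Fix 1" "c \<otimes> c = y \<otimes> y"
    using is_sum_of_squares_mono[OF c_square E_Fix] unfolding pythagorean_def by blast
  have cc: "c \<in> carrier L" using c_mem T_mem by blast
  have hy: "h y = y" "y \<in> T" using y(1) unfolding fixed_elements_def by auto
  have "c = y \<or> c = \<ominus> y" using square_eq_imp[OF cc T_mem[OF hy(2)] y(2)] .
  then have "h c = c" using hy h_minus by auto
  then have "c \<oplus> c = \<zero>" using hc cc by (metis r_neg)
  then have "(\<one> \<oplus> \<one>) \<otimes> c = \<zero>" using cc by (simp add: l_distr)
  then show False using integral[OF _ _ cc] two_nonzero c_nonzero by blast
qed

text \<open>Reality passes from \<open>E\<close> to \<open>F\<close> by odd degree, then to the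
  pythagorean closure \<open>T\<close>, and down to its subfields.\<close>

lemma formally_real_Fix:
  assumes "formally_real L E"
  shows "formally_real L (Fix 1)"
proof -
  obtain M where M: "F \<subseteq> M" "formally_real L M"
    using formally_real_compositum[OF E subset_refl assms] by metis
  then have "formally_real L F"
    unfolding formally_real_def using is_sum_of_squares_mono by blast
  then have "formally_real L T" using formally_real_pyth_closure[OF F] by blast
  then show ?thesis
    unfolding formally_real_def using is_sum_of_squares_mono Fix_T by blast
qed

end

theorem corollary7p5:
  fixes L :: "('a, 'b) ring_scheme" and E F :: "'a set" and p :: nat
  assumes "algebraic_closure L E"
    and "prime p" and "odd p"
    and "\<not> pythagorean L E"
    and "galois_extension L E F"
    and "ring.dimension L p E F"
  shows "let good = (\<lambda>E0.
            algebraic_extension L E E0 \<and>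
            \<not> pythagorean L E0 \<and>
            linearly_disjoint L E E0 F \<and>
            (let F0 = compositum L E0 F in
              pyth_closure L F0 = compositum L (pyth_closure L E0) F \<and>
              ring.dimension L p (pyth_closure L E0) (pyth_closure L F0)))
         in (\<exists>E0. good E0) \<and>
            (formally_real L E \<longrightarrow> (\<exists>E0. good E0 \<and> formally_real L E0)) \<and>
            (\<forall>E0. good E0 \<longrightarrow> \<not> hereditarily_non_pythagorean L (pyth_closure L E0))"
proof -
  have closed: "algebraically_closed L"
  proof -
    interpret algebraic_closure L E using assms(1) .
    show ?thesis by (rule algebraically_closed_axioms)
  qed
  interpret odd_prime_galois L E F p
    by (intro odd_prime_galois.intro odd_prime_galois_axioms.intro closed assms)
  have two: "\<one>\<^bsub>L\<^esub> \<oplus>\<^bsub>L\<^esub> \<one>\<^bsub>L\<^esub> \<noteq> \<zero>\<^bsub>L\<^esub>"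
    using char_two_pythagorean[OF E] assms(4) by blast
  obtain d where d: "is_sum_of_squares L E d" "\<And>y. y \<in> E \<Longrightarrow> d \<noteq> y \<otimes>\<^bsub>L\<^esub> y"
    using assms(4) unfolding pythagorean_def by blast
  have dE: "d \<in> E" using is_sum_of_squares_mem[OF d(1) subfieldE(1)[OF E]] .
  obtain c where c: "c \<in> carrier L" "c \<otimes>\<^bsub>L\<^esub> c = d"
    using exists_square_root[of d] dE subfieldE(3)[OF E] by blast
  have cE: "c \<notin> E" using d(2) c(2) by blast
  have E_cl: "E \<subseteq> pyth_closure L F" using E_F pyth_closure_incl[of F L] by blast
  have cT: "c \<in> pyth_closure L F"
    by (rule pyth_closure_sqrt_sum_of_squares[OF F _ c(1)])
      (use is_sum_of_squares_mono[OF d(1) E_cl] c(2) in simp)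
  have c0: "c \<noteq> \<zero>\<^bsub>L\<^esub>" using cE subringE(2)[OF subfieldE(1)[OF E]] by blast
  have c2: "c \<otimes>\<^bsub>L\<^esub> c \<in> E" using c(2) dE by simp
  obtain h x where h: "subfield_endo L (pyth_closure L F) h" "x \<in> F" "h x \<in> F" "h x \<noteq> x"
    "\<And>k. k \<in> E \<Longrightarrow> h k = k" "h c = \<ominus>\<^bsub>L\<^esub> c"
    by (rule exists_conjugating_endo[OF cT c2 cE]) blast
  interpret conjugating_endo L E F p h x c
    by (intro conjugating_endo.intro conjugating_endo_axioms.intro odd_prime_galois_axioms)
      (use h two cT c0 c d(1) in simp_all)
  \<comment> \<open>The exponent 1 keeps this field in the form \<open>Fix 1\<close>, so that the
    facts about \<open>Fix m\<close> apply to it literally.\<close>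
  let ?E0 = "fixed_elements (pyth_closure L F) (h ^^ 1)"
  have alg: "algebraic_extension L E ?E0"
    unfolding algebraic_extension_def field_extension_def
    using E Fix_subfield[of 1] E_Fix[of 1] algebraic_closure.algebraic_extension[OF assms(1)]
      subfieldE(3)[OF Fix_subfield[of 1]] by blast
  have comp: "compositum L ?E0 F = Fix p" using compositum_Fix .
  have P: "pyth_closure L (Fix p) = compositum L (pyth_closure L ?E0) F"
  proof (rule compositum_eqI[OF _ F _ _ _ pyth_closure_Fix_Span(2) powers_F, symmetric])
    show "subfield (pyth_closure L ?E0) L" "subfield (pyth_closure L (Fix p)) L"
      by (rule pyth_closure_subfield[OF Fix_subfield])+
    show "pyth_closure L ?E0 \<subseteq> pyth_closure L (Fix p)"
      using pyth_closure_mono[OF Fix_subfield] Fix_mono[of 1 p] pyth_closure_incl[of "Fix p" L]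
      by simp
    show "F \<subseteq> pyth_closure L (Fix p)"
      using F_Fix[of 1] pyth_closure_incl[of "Fix p" L] by auto
  qed
  have dim: "ring.dimension L p (pyth_closure L ?E0) (pyth_closure L (Fix p))"
    using dimensionI[OF pyth_closure_subfield[OF Fix_subfield] pyth_closure_Fix_Span(1)]
      pyth_closure_Fix_Span(2) by (simp add: exp_base_def)
  show ?thesis
    unfolding Let_def
    using alg not_pythagorean_Fix linearly_disjoint_Fix comp P dim formally_real_Fix
      not_hereditarily_non_pythagorean by metis
qed

end
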